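(* Let $m,n,d$ be positive integers with $m<n$. Put $\alpha=\lfloor md/(n-m)\rfloor$ and $s=md \bmod (n-m)$, and let $\mathcal K_{rp}$ be the complete eigenstructure of $m\times n$ matrix polynomials of grade $d$ consisting of: no elementary divisors (neither finite nor infinite); no left minimal indices; and the right minimal indices $$\underbrace{\alpha+1,\dots,\alpha+1}_{s},\ \underbrace{\alpha,\dots,\alpha}_{n-m-s}.$$ Then: (i) There exists an $m\times n$ complex matrix polynomial $K_{rp}$ of degree exactly $d$ and rank exactly $m$ with the complete eigenstructure $\mathcal K_{rp}$. (ii) $\overline{\mathrm{O}}(K_{rp})=\mathrm{POL}_{d,m\times n}$.
   Context: All matrices are complex. An $m\times n$ matrix polynomial of grade $d$ is an expression $P(\lambda)=\lambda^dA_d+\dots+\lambda A_1+A_0$ with $A_i\in\mathbb C^{m\times n}$ (so its degree is at most $d$; $A_d=0$ is allowed). $\mathrm{POL}_{d,m\times n}$ is the vector space of all of these, with the metric $d(P,P')=\big(\sum_{i=0}^d\|A_i-A_i'\|_F^2\big)^{1/2}$ ($\|\cdot\|_F$ the Frobenius norm). Rank means normal rank, i.e. the rank of $P(\lambda)$ over the field $\mathbb C(\lambda)$. By the Smith form, if $P$ has rank $r$ there are matrix polynomials $U(\lambda),V(\lambda)$ with nonzero constant determinants such that $U(\lambda)P(\lambda)V(\lambda)$ is zero except for diagonal entries $g_1(\lambda),\dots,g_r(\lambda)$ in the leading $r\times r$ block, where the $g_j$ are monic and $g_j\mid g_{j+1}$; these $g_j$ are unique. Write $g_j(\lambda)=\prod_k(\lambda-\alpha_k)^{\delta_{jk}}$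 with distinct $\alpha_k$ and $\delta_{jk}>0$. The $\alpha_k$ are the finite eigenvalues, and the factors $(\lambda-\alpha_k)^{\delta_{jk}}$, collected over all $j$ with repetitions, are the elementary divisors associated with finite eigenvalues. For $P$ of grade $d$, let $\mathrm{rev}\,P(\lambda)=\lambda^dP(1/\lambda)$; the elementary divisors of $P$ associated with the eigenvalue $\infty$ are the elementary divisors $\lambda^{\gamma}$, $\gamma>0$, of $\mathrm{rev}\,P$ associated with its eigenvalue $0$. A minimal basis of a subspace $\mathcal V$ of a space of vectors over $\mathbb C(\lambda)$ is a basis of $\mathcal V$ consisting of vector polynomials whose sum of degrees is minimal among all such bases; the ordered list of degrees is the same for every minimal basis and is called the list of minimal indices of $\mathcal V$. For $P$ of rank $r$, the right minimal indices of $P$ are the $n-r$ minimal indices of $\{x(\lambda)\in\mathbb C(\lambda)^{n\times 1}: P(\lambda)x(\lambda)=0\}$ and the left minimal indices of $P$ are the $m-r$ minimal indices of $\{y(\lambda)^T\in\mathbb C(\lambda)^{1\times m}: y(\lambda)^TP(\lambda)=0\}$. The complete eigenstructure of $P$ (of grade $d$) consists of all its eigenvalues, finite and infinite, the corresponding elementary divisors, and its left and right minimal indices. $\mathrm{O}(P)$ denotes the set of all matrix polynomials of the same size, the same grade $d$ and with the same complete eigenstructure as $P$; $\overline{\mathrm{O}}(P)$ denotes its closure in the metric space $\mathrm{POL}_{d,m\times n}$. *)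

theory Defs
  imports
    "HOL-Analysis.Abstract_Metric_Spaces"
    "HOL-Analysis.L2_Norm"
    "HOL-Computational_Algebra.Polynomial_Factorial"
    "Jordan_Normal_Form.DL_Rank"
    "Jordan_Normal_Form.Matrix_Kernel"
begin

text \<open>A matrix polynomial is a matrix over the ring of complex polynomials; its grade \<open>d\<close> is not
  part of the matrix but a parameter of every notion that depends on it.\<close>

definition POL :: "nat \<Rightarrow> nat \<Rightarrow> nat \<Rightarrow> complex poly mat set" where
  "POL d m n = {P \<in> carrier_mat m n. \<forall>i<m. \<forall>j<n. degree (P $$ (i, j)) \<le> d}"

definition mat_degree :: "complex poly mat \<Rightarrow> nat" where
  "mat_degree P = Max (degree ` elements_mat P)"

definition frobenius_norm :: "complex mat \<Rightarrow> real" where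
  "frobenius_norm A = sqrt (\<Sum>i<dim_row A. \<Sum>j<dim_col A. (cmod (A $$ (i, j)))\<^sup>2)"

text \<open>The matrix inside the norm is the difference of the \<open>k\<close>-th coefficient matrices. Its size is
  fixed to \<open>m\<close> by \<open>n\<close> so that the function is symmetric also outside \<open>POL\<close>, as the locale
  \<open>Metric_space\<close> requires.\<close>

definition pol_dist :: "nat \<Rightarrow> nat \<Rightarrow> nat \<Rightarrow> complex poly mat \<Rightarrow> complex poly mat \<Rightarrow> real" where
  "pol_dist d m n P Q = sqrt (\<Sum>k\<le>d.
     (frobenius_norm (mat m n (\<lambda>ij. coeff (P $$ ij) k - coeff (Q $$ ij) k)))\<^sup>2)"

definition POL_topology :: "nat \<Rightarrow> nat \<Rightarrow> nat \<Rightarrow> complex poly mat topology" where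
  "POL_topology d m n = Metric_space.mtopology (POL d m n) (pol_dist d m n)"

lemma pol_dist_L2_set:
  "pol_dist d m n P Q = L2_set (\<lambda>(k, i, j). cmod (coeff (P $$ (i, j)) k - coeff (Q $$ (i, j)) k))
     ({..d} \<times> {..<m} \<times> {..<n})"
  by (simp add: pol_dist_def frobenius_norm_def L2_set_def sum_nonneg
      sum.cartesian_product split_def)

lemma Metric_space_POL: "Metric_space (POL d m n) (pol_dist d m n)"
proof
  fix P Q R :: "complex poly mat"
  show "0 \<le> pol_dist d m n P Q"
    by (simp add: pol_dist_L2_set)
  show "pol_dist d m n P Q = pol_dist d m n Q P"
    by (simp add: pol_dist_L2_set norm_minus_commute)
  have "pol_dist d m n P R \<le> L2_set (\<lambda>x.
      (case x of (k, i, j) \<Rightarrow> cmod (coeff (P $$ (i, j)) k - coeff (Q $$ (i, j)) k)) +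
      (case x of (k, i, j) \<Rightarrow> cmod (coeff (Q $$ (i, j)) k - coeff (R $$ (i, j)) k)))
      ({..d} \<times> {..<m} \<times> {..<n})"
    unfolding pol_dist_L2_set
    by (rule L2_set_mono) (auto intro: norm_diff_triangle_le)
  also have "\<dots> \<le> pol_dist d m n P Q + pol_dist d m n Q R"
    unfolding pol_dist_L2_set by (rule L2_set_triangle_ineq)
  finally show "pol_dist d m n P R \<le> pol_dist d m n P Q + pol_dist d m n Q R" .
  assume P: "P \<in> POL d m n" and Q: "Q \<in> POL d m n"
  show "pol_dist d m n P Q = 0 \<longleftrightarrow> P = Q"
  proof
    assume "pol_dist d m n P Q = 0"
    then have eq: "coeff (P $$ (i, j)) k = coeff (Q $$ (i, j)) k"
      if "k \<le> d" "i < m" "j < n" for i j k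
      using that by (auto simp: pol_dist_L2_set L2_set_eq_0_iff)
    have "P $$ (i, j) = Q $$ (i, j)" if "i < m" "j < n" for i j
    proof (rule poly_eqI)
      fix k
      have "degree (P $$ (i, j)) \<le> d" "degree (Q $$ (i, j)) \<le> d"
        using P Q that by (auto simp: POL_def)
      then show "coeff (P $$ (i, j)) k = coeff (Q $$ (i, j)) k"
        using eq[of k i j] that by (cases "k \<le> d") (auto simp: coeff_eq_0)
    qed
    then show "P = Q"
      using P Q by (auto simp: POL_def intro!: eq_matI)
  qed (simp add: pol_dist_L2_set L2_set_eq_0_iff)
qed

abbreviation rat_mat :: "complex poly mat \<Rightarrow> complex poly fract mat" where
  "rat_mat \<equiv> map_mat to_fract"

text \<open>Rank over the field of rational functions.\<close>

definition normal_rank :: "complex poly mat \<Rightarrow> nat" where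
  "normal_rank P = vec_space.rank (dim_row P) (rat_mat P)"

definition smith_form :: "complex poly mat \<Rightarrow> complex poly list \<Rightarrow> bool" where
  "smith_form P gs \<longleftrightarrow>
     length gs = normal_rank P \<and>
     (\<forall>g\<in>set gs. lead_coeff g = 1) \<and>
     (\<forall>j. Suc j < length gs \<longrightarrow> gs ! j dvd gs ! Suc j) \<and>
     (\<exists>U V. U \<in> carrier_mat (dim_row P) (dim_row P) \<and> (\<exists>c. c \<noteq> 0 \<and> det U = [:c:]) \<and>
            V \<in> carrier_mat (dim_col P) (dim_col P) \<and> (\<exists>c. c \<noteq> 0 \<and> det V = [:c:]) \<and>
            U * P * V = mat (dim_row P) (dim_col P)
              (\<lambda>(i, j). if i = j \<and> i < length gs then gs ! i else 0))"

text \<open>Well defined because every matrix polynomial has a Smith form, with unique invariant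
  polynomials. The same holds for \<open>minimal_indices\<close> below: all minimal bases have the same
  degrees.\<close>

definition invariant_polys :: "complex poly mat \<Rightarrow> complex poly list" where
  "invariant_polys P = (THE gs. smith_form P gs)"

definition finite_eigenvalues :: "complex poly mat \<Rightarrow> complex set" where
  "finite_eigenvalues P = {\<alpha>. \<exists>g\<in>set (invariant_polys P). poly g \<alpha> = 0}"

text \<open>The elementary divisors associated with \<open>\<alpha>\<close>; empty if \<open>\<alpha>\<close> is not an eigenvalue.\<close>

definition eldivs_at :: "complex \<Rightarrow> complex poly mat \<Rightarrow> complex poly multiset" where
  "eldivs_at \<alpha> P =
     {# [:- \<alpha>, 1:] ^ order \<alpha> g. g \<in># filter_mset (\<lambda>g. poly g \<alpha> = 0) (mset (invariant_polys P)) #}"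

text \<open>For \<open>degree p \<le> d\<close> this is \<open>x^d p(1/x)\<close>.\<close>

definition rev_poly :: "nat \<Rightarrow> complex poly \<Rightarrow> complex poly" where
  "rev_poly d p = (\<Sum>k\<le>d. monom (coeff p (d - k)) k)"

definition rev_mat :: "nat \<Rightarrow> complex poly mat \<Rightarrow> complex poly mat" where
  "rev_mat d P = map_mat (rev_poly d) P"

text \<open>Only used for nonzero vectors, so the set under \<open>Max\<close> is nonempty.\<close>

definition vec_degree :: "complex poly vec \<Rightarrow> nat" where
  "vec_degree v = Max (degree ` set\<^sub>v v)"

text \<open>\<open>V\<close> is a subspace of the space of vectors of length \<open>n\<close> over the rational functions. Finiteness of
  \<open>B\<close> is automatic, since that space has finite dimension.\<close>

definition poly_basis :: "nat \<Rightarrow> complex poly fract vec set \<Rightarrow> complex poly vec set \<Rightarrow> bool" where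
  "poly_basis n V B \<longleftrightarrow> finite B \<and> B \<subseteq> carrier_vec n \<and>
     vectorspace.basis class_ring (module_vec TYPE(complex poly fract) n \<lparr>carrier := V\<rparr>)
       (map_vec to_fract ` B)"

definition minimal_basis :: "nat \<Rightarrow> complex poly fract vec set \<Rightarrow> complex poly vec set \<Rightarrow> bool" where
  "minimal_basis n V B \<longleftrightarrow> poly_basis n V B \<and>
     (\<forall>B'. poly_basis n V B' \<longrightarrow> (\<Sum>b\<in>B. vec_degree b) \<le> (\<Sum>b\<in>B'. vec_degree b))"

text \<open>Lists of minimal indices are put in decreasing order.\<close>

definition minimal_indices :: "nat \<Rightarrow> complex poly fract vec set \<Rightarrow> nat list" where
  "minimal_indices n V = (THE ds. \<exists>B. minimal_basis n V B \<and>
     ds = rev (sorted_list_of_multiset (image_mset vec_degree (mset_set B))))"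

definition right_minimal_indices :: "complex poly mat \<Rightarrow> nat list" where
  "right_minimal_indices P = minimal_indices (dim_col P) (mat_kernel (rat_mat P))"

text \<open>Row vectors are represented by \<open>vec\<close>; the one-row matrix formed from \<open>y\<close> is its transpose.\<close>

definition left_minimal_indices :: "complex poly mat \<Rightarrow> nat list" where
  "left_minimal_indices P = minimal_indices (dim_row P)
     {y \<in> carrier_vec (dim_row P). mat_of_rows (dim_row P) [y] * rat_mat P = 0\<^sub>m 1 (dim_col P)}"

record eigenstructure =
  finite_evs :: "complex set"
  infinite_ev :: bool
  finite_eldivs :: "complex poly multiset"
  infinite_eldivs :: "complex poly multiset"
  left_indices :: "nat list"
  right_indices :: "nat list"

definition complete_eigenstructure :: "nat \<Rightarrow> complex poly mat \<Rightarrow> eigenstructure" where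
  "complete_eigenstructure d P =
     \<lparr>finite_evs = finite_eigenvalues P,
      infinite_ev = (0 \<in> finite_eigenvalues (rev_mat d P)),
      finite_eldivs = (\<Sum>\<alpha>\<in>finite_eigenvalues P. eldivs_at \<alpha> P),
      infinite_eldivs = eldivs_at 0 (rev_mat d P),
      left_indices = left_minimal_indices P,
      right_indices = right_minimal_indices P\<rparr>"

text \<open>The set written \<open>O(P)\<close>, for \<open>P\<close> of grade \<open>d\<close>.\<close>

definition eig_orbit :: "nat \<Rightarrow> complex poly mat \<Rightarrow> complex poly mat set" where
  "eig_orbit d P = {Q \<in> POL d (dim_row P) (dim_col P).
     complete_eigenstructure d Q = complete_eigenstructure d P}"

definition K_rp :: "nat \<Rightarrow> nat \<Rightarrow> nat \<Rightarrow> eigenstructure" where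
  "K_rp d m n = (let \<alpha> = m * d div (n - m); s = m * d mod (n - m) in
     \<lparr>finite_evs = {},
      infinite_ev = False,
      finite_eldivs = {#},
      infinite_eldivs = {#},
      left_indices = [],
      right_indices = replicate s (\<alpha> + 1) @ replicate (n - m - s) \<alpha>\<rparr>)"

end

theory Submission
  imports Defs "HOL-Computational_Algebra.Fundamental_Theorem_Algebra"
begin

text \<open>
  Write \<open>\<alpha> = \<lfloor>md/(n-m)\<rfloor>\<close> and let \<open>S\<^sub>k\<close> be the complex-linear map \<open>x \<mapsto> P x\<close> from polynomial vectors
  of degree less than \<open>k\<close> to polynomial vectors of degree less than \<open>k + d\<close>. Call \<open>P\<close> of full rank
  if \<open>S\<close> is injective at \<open>k = \<alpha>\<close> and surjective at \<open>k = \<alpha> + 1\<close>; this forces the eigenstructure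
  \<open>K_rp\<close>. Surjectivity gives \<open>P\<close> a polynomial right inverse, hence a trivial Smith form, and the same
  holds for the reversal. Rank-nullity gives the number of kernel vectors of degree \<open>\<alpha>\<close> and
  \<open>\<alpha> + 1\<close>; a choice of \<open>n - m\<close> of them completes the right inverse to a unimodular matrix, and counting
  degrees shows that they form a minimal basis and that every other minimal basis has the same degrees.

  Full rank is a generic property: if \<open>K\<close> has it, then \<open>P + t K\<close> has it for all but finitely many
  \<open>t\<close>, the exceptions being eigenvalues of finite-dimensional operators. It remains to exhibit one
  \<open>K\<close> of full rank. The zigzag matrix used here has the breakpoints of \<open>[0, md]\<close> into \<open>m\<close>
  intervals of length \<open>d\<close> and into \<open>n - m\<close> intervals of length \<open>\<alpha>\<close> or \<open>\<alpha> + 1\<close> as its columns,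
  with monomial entries chosen so that \<open>K x = y\<close> decouples into one linear system with coefficients
  0 and 1 for each power of the variable.
\<close>

section \<open>Linear algebra in a finite-dimensional subspace\<close>

no_notation vector_scalar_mult (infixl "*s" 70)

context vector_space
begin

lemma span_Int_independent:
  assumes "finite A" "finite B" "A \<inter> B = {}" "independent (A \<union> B)" "x \<in> span A" "x \<in> span B"
  shows "x = 0"
proof -
  obtain u where u: "x = (\<Sum>v\<in>A. u v *s v)" using assms by (auto simp: span_finite)
  obtain w where w: "x = (\<Sum>v\<in>B. w v *s v)" using assms by (auto simp: span_finite)
  let ?g = "\<lambda>v. if v \<in> A then u v else - w v"
  have "(\<Sum>v\<in>A \<union> B. ?g v *s v) = (\<Sum>v\<in>A. ?g v *s v) + (\<Sum>v\<in>B. ?g v *s v)"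
    using assms by (intro sum.union_disjoint) auto
  also have "(\<Sum>v\<in>A. ?g v *s v) = x" unfolding u by (rule sum.cong) auto
  also have "(\<Sum>v\<in>B. ?g v *s v) = (\<Sum>v\<in>B. - (w v *s v))"
    using assms by (intro sum.cong) auto
  also have "\<dots> = - x" unfolding w by (simp add: sum_negf)
  finally have "(\<Sum>v\<in>A \<union> B. ?g v *s v) = 0" by simp
  then have "?g v = 0" if "v \<in> A" for v
    using independentD[OF assms(4) _ order_refl, of ?g v] assms that by auto
  then have "(\<Sum>v\<in>A. u v *s v) = 0" by (intro sum.neutral) simp
  then show ?thesis unfolding u .
qed

lemma independent_Un:
  assumes "finite A" "finite B" "independent A" "independent B"
    and Int: "\<And>x. x \<in> span A \<Longrightarrow> x \<in> span B \<Longrightarrow> x = 0"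
  shows "A \<inter> B = {}" "independent (A \<union> B)"
proof -
  show disj: "A \<inter> B = {}"
  proof (rule ccontr)
    assume "A \<inter> B \<noteq> {}"
    then obtain x where "x \<in> A" "x \<in> B" by auto
    then have "x = 0" using Int span_base by auto
    then show False using \<open>x \<in> A\<close> assms(3) dependent_zero by auto
  qed
  show "independent (A \<union> B)"
  proof (rule independent_if_scalars_zero)
    fix f x assume *: "(\<Sum>x\<in>A \<union> B. f x *s x) = 0" "x \<in> A \<union> B"
    let ?a = "\<Sum>x\<in>A. f x *s x" and ?b = "\<Sum>x\<in>B. f x *s x"
    have "?a + ?b = 0" using *(1) assms(1,2) disj by (simp add: sum.union_disjoint)
    then have eq: "?a = - ?b" by (simp add: eq_neg_iff_add_eq_0)
    have "?a \<in> span A" by (rule span_sum, rule span_scale, rule span_base)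
    moreover have "?b \<in> span B" by (rule span_sum, rule span_scale, rule span_base)
    then have "?a \<in> span B" unfolding eq by (rule span_neg)
    ultimately have a: "?a = 0" by (rule Int)
    with eq have b: "?b = 0" by simp
    show "f x = 0"
      using *(2) independentD[OF assms(3,1) subset_refl a] independentD[OF assms(4,2) subset_refl b]
      by auto
  qed (use assms in simp)
qed

text \<open>The formula is applied to polynomial vectors, whose ambient space has infinite
  dimension; hence it is relative to a subspace inside the span of a finite set. A basis
  \<open>B\<close> of the kernel part is extended to a basis \<open>A\<close> of \<open>V\<close>,
  and \<open>A - B\<close> maps injectively onto a basis of the image.\<close>

lemma rank_nullity_on:
  assumes f: "Vector_Spaces.linear scale scale f" and V: "subspace V" and T: "finite T" "V \<subseteq> span T"
  shows "dim V = dim {x \<in> V. f x = 0} + dim (f ` V)"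
proof -
  interpret f: Vector_Spaces.linear scale scale f by fact
  interpret vector_space_pair scale scale ..
  let ?K = "{x \<in> V. f x = 0}"
  obtain B where B: "B \<subseteq> ?K" "independent B" "?K \<subseteq> span B" "card B = dim ?K"
    by (rule basis_exists)
  obtain A where A: "B \<subseteq> A" "A \<subseteq> V" "independent A" "V \<subseteq> span A"
    using maximal_independent_subset_extend[of B V] B by blast
  have finA: "finite A"
    using independent_span_bound[OF T(1) A(3)] A(2) T(2) by auto
  then have finB: "finite B" using A(1) by (rule finite_subset[rotated])
  have fin: "finite (A - B)" using finA by simp
  have ker: "u v = 0" if sum: "(\<Sum>v\<in>A - B. u v *s f v) = 0" and v: "v \<in> A - B" for u v
  proof -
    let ?x = "\<Sum>v\<in>A - B. u v *s v"
    have "f ?x = 0" using sum by (simp add: f.sum f.scale)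
    moreover have "?x \<in> V" using A(2) V by (auto intro!: subspace_sum subspace_scale)
    ultimately have "?x \<in> span B" using B(3) by auto
    moreover have "?x \<in> span (A - B)" by (rule span_sum, rule span_scale, rule span_base)
    ultimately have "?x = 0"
      using span_Int_independent[of "A - B" B ?x] fin finB A(1,3)
      by (simp add: Un_absorb2 Diff_disjoint Int_commute)
    then show ?thesis
      using independentD[OF A(3) fin, of u v] v by auto
  qed
  have inj: "inj_on f (A - B)"
  proof (rule inj_onI, rule ccontr)
    fix v w assume *: "v \<in> A - B" "w \<in> A - B" "f v = f w" "v \<noteq> w"
    \<comment> \<open>Two equal images would give a relation with coefficients 1 and -1.\<close>
    let ?u = "\<lambda>x. if x = v then 1 else if x = w then - 1 else 0"
    have "(\<Sum>x\<in>A - B. ?u x *s f x) = (\<Sum>x\<in>{v, w}. ?u x *s f x)"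
      using * fin by (intro sum.mono_neutral_right) auto
    also have "\<dots> = 0" using * by simp
    finally show False using ker[of ?u v] * by simp
  qed
  have ind: "independent (f ` (A - B))"
  proof (rule independent_if_scalars_zero)
    fix g y assume "(\<Sum>x\<in>f ` (A - B). g x *s x) = 0" "y \<in> f ` (A - B)"
    then show "g y = 0" using ker[of "g \<circ> f"] by (auto simp: sum.reindex[OF inj])
  qed (use fin in auto)
  have "f ` V \<subseteq> f ` span A" using A(4) by blast
  also have "\<dots> = span (f ` A)" by (rule f.span_image[symmetric])
  also have "\<dots> \<subseteq> span (f ` (A - B))"
  proof (rule span_minimal)
    show "f ` A \<subseteq> span (f ` (A - B))"
    proof
      fix y assume "y \<in> f ` A"
      then obtain a where a: "a \<in> A" "y = f a" by blast
      show "y \<in> span (f ` (A - B))"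
      proof (cases "a \<in> B")
        case True
        then show ?thesis using a B(1) span_zero by auto
      qed (use a in \<open>auto intro!: span_base\<close>)
    qed
  qed simp
  finally have "dim (f ` V) = card (f ` (A - B))"
    using A(2) ind by (intro dim_unique[of "f ` (A - B)"]) auto
  moreover have "card (f ` (A - B)) = card A - card B"
    using A(1) finA finB by (simp add: card_image[OF inj] card_Diff_subset)
  moreover have "dim V = card A" using A by (intro dim_unique) auto
  moreover have "card B \<le> card A" using A(1) finA by (simp add: card_mono)
  ultimately show ?thesis using B(4) by simp
qed

lemma subspace_eq_if_dim_le:
  assumes "subspace U" "U \<subseteq> V" "finite T" "V \<subseteq> span T" "dim V \<le> dim U"
  shows "U = V"
proof (rule ccontr)
  assume "U \<noteq> V"
  then obtain y where y: "y \<in> V" "y \<notin> U" using assms(2) by blast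
  obtain B where B: "B \<subseteq> U" "independent B" "U \<subseteq> span B" "card B = dim U" by (rule basis_exists)
  have "span B \<subseteq> U" using B(1) assms(1) by (rule span_minimal)
  then have "y \<notin> span B" using y by blast
  then have ind: "independent (insert y B)" using B(2) by (rule independent_insertI)
  obtain C where C: "C \<subseteq> V" "independent C" "V \<subseteq> span C" "card C = dim V" by (rule basis_exists)
  have finC: "finite C" using independent_span_bound[OF assms(3) C(2)] C(1) assms(4) by auto
  have sub: "insert y B \<subseteq> span C" using y B(1) assms(2) C(3) by auto
  then have "finite (insert y B)" "card (insert y B) \<le> card C"
    using independent_span_bound[OF finC ind] by auto
  moreover have "y \<notin> B" using \<open>y \<notin> span B\<close> span_base by blast
  ultimately show False using B(4) C(4) assms(5) by simp
qed

section \<open>Exceptional parameters on a line of linear maps\<close>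

text \<open>Applying \<open>h - a\<close> to a relation removes the term at \<open>a\<close> and
  multiplies every other coefficient by the nonzero factor \<open>t - a\<close>, so induction
  applies. Stating it for a family lets injectivity of \<open>x\<close> follow from it
  later.\<close>

lemma eigenvectors_independent:
  assumes h: "Vector_Spaces.linear scale scale h" and "finite S"
    and eig: "\<And>t. t \<in> S \<Longrightarrow> x t \<noteq> 0" "\<And>t. t \<in> S \<Longrightarrow> h (x t) = t *s x t"
    and "(\<Sum>t\<in>S. u t *s x t) = 0" "t \<in> S"
  shows "u t = 0"
  using \<open>finite S\<close> eig assms(5,6)
proof (induction S arbitrary: u t)
  case (insert a S)
  interpret h: Vector_Spaces.linear scale scale h by fact
  have "0 = h (\<Sum>t\<in>insert a S. u t *s x t) - a *s (\<Sum>t\<in>insert a S. u t *s x t)"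
    unfolding insert.prems(3) by simp
  also have "\<dots> = (\<Sum>t\<in>insert a S. u t *s (t *s x t) - a *s (u t *s x t))"
    using insert.prems(2) by (simp add: h.sum h.scale scale_sum_right sum_subtractf del: sum.insert)
  also have "\<dots> = (\<Sum>t\<in>insert a S. (u t * (t - a)) *s x t)"
    by (rule sum.cong) (auto simp: scale_left_diff_distrib algebra_simps)
  also have "\<dots> = (\<Sum>t\<in>S. (u t * (t - a)) *s x t)"
    using insert.hyps by simp
  finally have "u t * (t - a) = 0" if "t \<in> S" for t
    using insert.IH[of "\<lambda>t. u t * (t - a)" t] insert.prems(1,2) that by auto
  then have S: "u t = 0" if "t \<in> S" for t
    using that insert.hyps(2) by (metis eq_iff_diff_eq_0 mult_eq_0_iff)
  then have "u a *s x a = 0" using insert.prems(3) insert.hyps by simp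
  then show ?case using S insert.prems by auto
qed simp

text \<open>A left inverse \<open>l\<close> of \<open>f\<close> on \<open>V\<close> turns
  \<open>g x + t *s f x = 0\<close> into the eigenvalue equation \<open>h x = t *s x\<close> for
  \<open>h = - l o g\<close>. Eigenvectors at distinct \<open>t\<close> are independent and lie in
  the span of \<open>T\<close>, so at most \<open>card T\<close> values are exceptional.\<close>

lemma finite_singular_parameters_inj:
  assumes f: "Vector_Spaces.linear scale scale f" and g: "Vector_Spaces.linear scale scale g"
    and V: "subspace V" and T: "finite T" "V \<subseteq> span T"
    and inj: "\<And>x. x \<in> V \<Longrightarrow> f x = 0 \<Longrightarrow> x = 0"
  shows "finite {t. \<exists>x\<in>V. x \<noteq> 0 \<and> g x + t *s f x = 0}" (is "finite ?S")
proof -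
  interpret f: Vector_Spaces.linear scale scale f by fact
  interpret g: Vector_Spaces.linear scale scale g by fact
  interpret vector_space_pair scale scale ..
  have "inj_on f V"
    using inj V by (metis (no_types, lifting) f.diff inj_onI right_minus_eq subspace_diff)
  then obtain l where l: "range l \<subseteq> V" "Vector_Spaces.linear scale scale l" "\<And>v. v \<in> V \<Longrightarrow> l (f v) = v"
    using linear_exists_left_inverse_on[OF f V] by blast
  interpret l: Vector_Spaces.linear scale scale l by fact
  define h where "h = (\<lambda>x. - l (g x))"
  have h: "Vector_Spaces.linear scale scale h"
  proof (unfold Vector_Spaces.linear_iff, intro conjI allI)
    show "h (x + y) = h x + h y" for x y by (simp only: h_def g.add l.add minus_add_distrib)
    show "h (c *s x) = c *s h x" for c x by (simp only: h_def g.scale l.scale scale_minus_right)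
  qed (rule vector_space_axioms)+
  have "\<exists>x. x \<in> V \<and> x \<noteq> 0 \<and> h x = t *s x" if "t \<in> ?S" for t
  proof -
    obtain x where x: "x \<in> V" "x \<noteq> 0" "g x + t *s f x = 0" using \<open>t \<in> ?S\<close> by blast
    have "l (g x + t *s f x) = 0" using x(3) by simp
    then have "l (g x) + t *s x = 0" using x(1) by (simp add: l.add l.scale l(3))
    then have "h x = t *s x" unfolding h_def by (simp only: neg_eq_iff_add_eq_0)
    with x show ?thesis by blast
  qed
  then have "\<forall>t\<in>?S. \<exists>x. x \<in> V \<and> x \<noteq> 0 \<and> h x = t *s x" by (intro ballI)
  from bchoice[OF this] obtain x
    where x: "x t \<in> V \<and> x t \<noteq> 0 \<and> h (x t) = t *s x t" if "t \<in> ?S" for t by (elim exE) (rule that, rule bspec)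
  have "card S' \<le> card T" if S': "S' \<subseteq> ?S" "finite S'" for S'
  proof -
    have zero: "u t = 0" if "(\<Sum>t\<in>S'. u t *s x t) = 0" "t \<in> S'" for u t
    proof (rule eigenvectors_independent[OF h S'(2) _ _ that])
      fix t assume "t \<in> S'"
      then have "t \<in> ?S" using S'(1) by blast
      from x[OF this] show "x t \<noteq> 0" "h (x t) = t *s x t" by auto
    qed
    have injx: "inj_on x S'"
    proof (rule inj_onI, rule ccontr)
      fix v w assume *: "v \<in> S'" "w \<in> S'" "x v = x w" "v \<noteq> w"
      let ?u = "\<lambda>t. if t = v then 1 else if t = w then - 1 else 0"
      have "(\<Sum>t\<in>S'. ?u t *s x t) = (\<Sum>t\<in>{v, w}. ?u t *s x t)"
        using * S'(2) by (intro sum.mono_neutral_right) auto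
      also have "\<dots> = 0" using * by simp
      finally show False using zero[of ?u v] * by simp
    qed
    have "independent (x ` S')"
    proof (rule independent_if_scalars_zero)
      fix g y assume "(\<Sum>y\<in>x ` S'. g y *s y) = 0" "y \<in> x ` S'"
      then show "g y = 0" using zero[of "g \<circ> x"] by (auto simp: sum.reindex[OF injx])
    qed (use S'(2) in auto)
    moreover have "x ` S' \<subseteq> span T"
    proof (rule image_subsetI)
      fix t assume "t \<in> S'"
      then have "t \<in> ?S" using S'(1) by (rule subsetD[rotated])
      from x[OF this] show "x t \<in> span T" using T(2) by (simp add: subsetD)
    qed
    ultimately have "card (x ` S') \<le> card T" using independent_span_bound[OF T(1)] by blast
    then show ?thesis by (simp add: card_image[OF injx])
  qed
  then show ?thesis using finite_if_finite_subsets_card_bdd[of ?S] by blast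
qed

text \<open>With a right inverse \<open>r\<close> of \<open>f\<close> on \<open>W\<close>, the map
  \<open>g o r + t\<close> sends \<open>W\<close> into itself. It is injective for all but finitely
  many \<open>t\<close>, hence surjective by finite dimension, and \<open>r\<close> carries the
  preimages into \<open>V\<close>.\<close>

lemma finite_singular_parameters_surj:
  assumes f: "Vector_Spaces.linear scale scale f" and g: "Vector_Spaces.linear scale scale g"
    and V: "subspace V" and W: "subspace W" and T: "finite T" "W \<subseteq> span T"
    and fV: "f ` V = W" and gV: "g ` V \<subseteq> W"
  shows "finite {t. \<not> W \<subseteq> (\<lambda>x. g x + t *s f x) ` V}"
proof -
  interpret f: Vector_Spaces.linear scale scale f by fact
  interpret g: Vector_Spaces.linear scale scale g by fact
  interpret vector_space_pair scale scale ..
  obtain r where r: "range r \<subseteq> V" "Vector_Spaces.linear scale scale r" "\<And>w. w \<in> W \<Longrightarrow> f (r w) = w"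
    using linear_exists_right_inverse_on[OF f V] fV by blast
  interpret r: Vector_Spaces.linear scale scale r by fact
  have gr: "Vector_Spaces.linear scale scale (\<lambda>x. g (r x))"
    unfolding Vector_Spaces.linear_iff by (auto simp: vector_space_axioms g.add r.add g.scale r.scale)
  let ?S = "{t. \<exists>x\<in>W. x \<noteq> 0 \<and> g (r x) + t *s id x = 0}"
  have "finite ?S"
    by (rule finite_singular_parameters_inj[OF linear_id gr W T]) simp
  moreover have "{t. \<not> W \<subseteq> (\<lambda>x. g x + t *s f x) ` V} \<subseteq> ?S"
  proof (rule subsetI, rule ccontr)
    fix t assume t: "t \<in> {t. \<not> W \<subseteq> (\<lambda>x. g x + t *s f x) ` V}" "t \<notin> ?S"
    let ?h = "\<lambda>x. g (r x) + t *s x"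
    have h: "Vector_Spaces.linear scale scale ?h"
      unfolding Vector_Spaces.linear_iff
      by (auto simp: vector_space_axioms g.add r.add g.scale r.scale scale_right_distrib
          scale_left_commute)
    have hW: "?h ` W \<subseteq> W"
    proof
      fix y assume "y \<in> ?h ` W"
      then obtain x where x: "x \<in> W" "y = ?h x" by (rule imageE)
      have "g (r x) \<in> W" using gV r(1) by (simp add: image_subset_iff)
      then show "y \<in> W" using x W by (simp add: subspace_add subspace_scale)
    qed
    have "x = 0" if "x \<in> W" "?h x = 0" for x
      using t(2) that by auto
    then have "{x \<in> W. ?h x = 0} = {0}"
      using W by (auto simp: subspace_0 g.zero r.zero)
    then have "dim {x \<in> W. ?h x = 0} = 0"
      using dim_eq_card[OF _ independent_empty, of "{0}"] by (simp only: span_insert_0 card.empty)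
    then have "dim W \<le> dim (?h ` W)" using rank_nullity_on[OF h W T] by linarith
    moreover have "subspace (?h ` W)"
      by (rule module_hom.subspace_image[OF h[folded module_hom_iff_linear] W])
    ultimately have eq: "?h ` W = W"
      using subspace_eq_if_dim_le[OF _ hW T] by simp
    have "W \<subseteq> (\<lambda>x. g x + t *s f x) ` V"
    proof
      fix y assume "y \<in> W"
      then have "y \<in> ?h ` W" unfolding eq .
      then obtain w where w: "w \<in> W" "y = ?h w" by (rule imageE)
      have "y = g (r w) + t *s f (r w)" unfolding r(3)[OF w(1)] by (rule w(2))
      then show "y \<in> (\<lambda>x. g x + t *s f x) ` V" using r(1) by blast
    qed
    then show False using t(1) by blast
  qed
  ultimately show ?thesis by (rule finite_subset[rotated])
qed

end

section \<open>Polynomial vectors of bounded degree\<close>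

text \<open>The vector with polynomial entries \<open>x\<^sub>j\<close> is encoded as the bivariate polynomial with coefficients
  \<open>x\<^sub>j\<close>, because a type, unlike the carriers of matrix theory, can instantiate \<open>vector_space\<close>. In
  \<open>vpoly n k\<close> the bound \<open>k\<close> on the degree of the entries is strict.\<close>

abbreviation cscale :: "complex \<Rightarrow> complex poly poly \<Rightarrow> complex poly poly" where
  "cscale c \<equiv> Polynomial.smult [:c:]"

global_interpretation cvec: vector_space cscale
proof
  fix a b and x y :: "complex poly poly"
  show "cscale a (x + y) = cscale a x + cscale a y" by (rule smult_add_right)
  have "[:a + b:] = [:a:] + [:b:]" by simp
  then show "cscale (a + b) x = cscale a x + cscale b x" by (simp only: smult_add_left)
  show "cscale a (cscale b x) = cscale (a * b) x" by (simp add: mult.commute)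
  show "cscale 1 x = x" by (simp flip: one_pCons)
qed

definition vpoly :: "nat \<Rightarrow> nat \<Rightarrow> complex poly poly set" where
  "vpoly n k = {x. \<forall>j e. n \<le> j \<or> k \<le> e \<longrightarrow> coeff (coeff x j) e = 0}"

definition vec_of :: "nat \<Rightarrow> (nat \<Rightarrow> complex poly) \<Rightarrow> complex poly poly" where
  "vec_of n f = (\<Sum>j<n. monom (f j) j)"

definition act :: "complex poly mat \<Rightarrow> complex poly poly \<Rightarrow> complex poly poly" where
  "act P x = vec_of (dim_row P) (\<lambda>i. \<Sum>j<dim_col P. P $$ (i, j) * coeff x j)"

lemma coeff_vec_of [simp]: "coeff (vec_of n f) j = (if j < n then f j else 0)"
  by (simp add: vec_of_def coeff_sum)

lemma coeff_act: "coeff (act P x) i =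
    (if i < dim_row P then \<Sum>j<dim_col P. P $$ (i, j) * coeff x j else 0)"
  by (simp add: act_def)

lemma coeff2_eqI: "(\<And>j e. coeff (coeff x j) e = coeff (coeff y j) e) \<Longrightarrow> x = y"
  by (intro poly_eqI) simp

lemma vpoly_coeff: "x \<in> vpoly n k \<Longrightarrow> n \<le> j \<or> k \<le> e \<Longrightarrow> coeff (coeff x j) e = 0"
  by (auto simp: vpoly_def)

lemma vpolyI: "(\<And>j e. n \<le> j \<or> k \<le> e \<Longrightarrow> coeff (coeff x j) e = 0) \<Longrightarrow> x \<in> vpoly n k"
  by (auto simp: vpoly_def)

lemma vpoly_coeff_zero: "x \<in> vpoly n k \<Longrightarrow> n \<le> j \<Longrightarrow> coeff x j = 0"
  by (intro poly_eqI) (simp add: vpoly_coeff)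

lemma vpoly_mono: "n \<le> n' \<Longrightarrow> k \<le> k' \<Longrightarrow> vpoly n k \<subseteq> vpoly n' k'"
  by (auto simp: vpoly_def)

lemma vpoly_Suc_iff:
  "x \<in> vpoly n (Suc k) \<longleftrightarrow> (\<forall>j\<ge>n. coeff x j = 0) \<and> (\<forall>j. degree (coeff x j) \<le> k)"
proof
  assume x: "x \<in> vpoly n (Suc k)"
  then show "(\<forall>j\<ge>n. coeff x j = 0) \<and> (\<forall>j. degree (coeff x j) \<le> k)"
    by (auto intro!: degree_le simp: vpoly_coeff vpoly_coeff_zero)
next
  assume x: "(\<forall>j\<ge>n. coeff x j = 0) \<and> (\<forall>j. degree (coeff x j) \<le> k)"
  show "x \<in> vpoly n (Suc k)"
  proof (rule vpolyI)
    fix j e assume "n \<le> j \<or> Suc k \<le> e"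
    with x show "coeff (coeff x j) e = 0"
      by (metis coeff_0 coeff_eq_0 le_trans not_less_eq_eq not_le)
  qed
qed

lemma vpoly_0_right: "x \<in> vpoly n 0 \<Longrightarrow> x = 0"
  by (rule coeff2_eqI) (simp add: vpoly_coeff)

lemma subspace_vpoly: "cvec.subspace (vpoly n k)"
  by (auto simp: cvec.subspace_def vpoly_def)

text \<open>This encodes \<lambda>^e times the \<open>j\<close>-th unit vector: the inner exponent
  is the power, the outer one the position.\<close>

definition vmon :: "nat \<Rightarrow> nat \<Rightarrow> complex poly poly" where
  "vmon j e = monom (monom 1 e) j"

lemma coeff_vmon: "coeff (coeff (vmon j e) i) f = (if i = j \<and> f = e then 1 else 0)"
  by (auto simp: vmon_def)

lemma vpoly_expansion:
  assumes "x \<in> vpoly n k"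
  shows "x = (\<Sum>(j, e)\<in>{..<n} \<times> {..<k}. cscale (coeff (coeff x j) e) (vmon j e))"
proof (rule coeff2_eqI)
  fix j e
  have "coeff (coeff (\<Sum>p\<in>{..<n} \<times> {..<k}.
      case p of (j, e) \<Rightarrow> cscale (coeff (coeff x j) e) (vmon j e)) j) e =
    (\<Sum>p\<in>{..<n} \<times> {..<k}. if p = (j, e) then coeff (coeff x j) e else 0)"
    unfolding coeff_sum by (rule sum.cong) (auto simp: coeff_vmon split: prod.splits)
  also have "\<dots> = coeff (coeff x j) e"
    using assms by (auto simp: sum.delta' vpoly_coeff not_less)
  finally show "coeff (coeff x j) e = coeff (coeff (\<Sum>(j, e)\<in>{..<n} \<times> {..<k}.
      cscale (coeff (coeff x j) e) (vmon j e)) j) e" ..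
qed

lemma vmon_in_vpoly: "j < n \<Longrightarrow> e < k \<Longrightarrow> vmon j e \<in> vpoly n k"
  by (auto simp: vpoly_def coeff_vmon)

definition vbasis :: "nat \<Rightarrow> nat \<Rightarrow> complex poly poly set" where
  "vbasis n k = (\<lambda>(j, e). vmon j e) ` ({..<n} \<times> {..<k})"

lemma finite_vbasis: "finite (vbasis n k)"
  by (simp add: vbasis_def)

lemma vpoly_subset_span: "vpoly n k \<subseteq> cvec.span (vbasis n k)"
proof
  fix x assume "x \<in> vpoly n k"
  note vpoly_expansion[OF this]
  also have "(\<Sum>(j, e)\<in>{..<n} \<times> {..<k}. cscale (coeff (coeff x j) e) (vmon j e))
    \<in> cvec.span (vbasis n k)"
    by (rule cvec.span_sum) (force simp: vbasis_def intro: cvec.span_scale cvec.span_base)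
  finally show "x \<in> cvec.span (vbasis n k)" .
qed

lemma inj_vmon: "inj_on (\<lambda>(j, e). vmon j e) A"
proof (rule inj_onI, clarify)
  fix j e j' e' assume "vmon j e = vmon j' e'"
  then have "coeff (coeff (vmon j e) j) e = coeff (coeff (vmon j' e') j) e" by simp
  then show "j = j' \<and> e = e'" by (simp add: coeff_vmon split: if_splits)
qed

lemma dim_vpoly: "cvec.dim (vpoly n k) = n * k"
proof (rule cvec.dim_unique)
  show "vbasis n k \<subseteq> vpoly n k" by (auto simp: vbasis_def vmon_in_vpoly)
  show "vpoly n k \<subseteq> cvec.span (vbasis n k)" by (rule vpoly_subset_span)
  show "card (vbasis n k) = n * k" by (simp add: vbasis_def card_image[OF inj_vmon])
  show "cvec.independent (vbasis n k)"
  proof (rule cvec.independent_if_scalars_zero[OF finite_vbasis])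
    fix f x assume sum: "(\<Sum>x\<in>vbasis n k. cscale (f x) x) = 0" and "x \<in> vbasis n k"
    then obtain j e where je: "j < n" "e < k" "x = vmon j e" by (auto simp: vbasis_def)
    have "0 = coeff (coeff (\<Sum>x\<in>vbasis n k. cscale (f x) x) j) e" unfolding sum by simp
    also have "\<dots> = (\<Sum>p\<in>{..<n} \<times> {..<k}. if p = (j, e) then f x else 0)"
      unfolding vbasis_def sum.reindex[OF inj_vmon] coeff_sum
      by (rule sum.cong) (auto simp: coeff_vmon je split: if_splits)
    also have "\<dots> = f x" using je by (simp add: sum.delta')
    finally show "f x = 0" ..
  qed
qed

lemma linear_act: "Vector_Spaces.linear cscale cscale (act P)"
  unfolding Vector_Spaces.linear_iff
  by (auto simp: cvec.vector_space_axioms poly_eq_iff coeff_act distrib_left sum.distrib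
      sum_distrib_left coeff_sum intro!: sum.cong)

lemma act_smult: "act P (Polynomial.smult p x) = Polynomial.smult p (act P x)"
  by (auto intro!: poly_eqI simp: coeff_act sum_distrib_left mult.left_commute)

lemma degree_POL: "P \<in> POL d m n \<Longrightarrow> i < m \<Longrightarrow> j < n \<Longrightarrow> degree (P $$ (i, j)) \<le> d"
  by (auto simp: POL_def)

lemma dim_POL: "P \<in> POL d m n \<Longrightarrow> dim_row P = m" "P \<in> POL d m n \<Longrightarrow> dim_col P = n"
  by (auto simp: POL_def)

lemma act_in_vpoly:
  assumes P: "P \<in> POL d m n" and x: "x \<in> vpoly n k"
  shows "act P x \<in> vpoly m (k + d)"
proof (cases k)
  case 0
  then show ?thesis
    using vpoly_0_right[of x n] x by (simp add: vpoly_def coeff_act)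
next
  case (Suc k')
  have "degree (coeff (act P x) i) \<le> k' + d" for i
  proof (cases "i < m")
    case True
    have "degree (P $$ (i, j) * coeff x j) \<le> k' + d" if "j < n" for j
    proof -
      have "degree (coeff x j) \<le> k'" using x Suc by (simp add: vpoly_Suc_iff)
      then show ?thesis
        using degree_mult_le[of "P $$ (i, j)" "coeff x j"] degree_POL[OF P True that] by linarith
    qed
    then show ?thesis
      using True by (auto simp: coeff_act dim_POL[OF P] intro!: degree_sum_le)
  qed (simp add: coeff_act dim_POL[OF P])
  then show ?thesis
    using Suc by (auto simp: vpoly_Suc_iff coeff_act dim_POL[OF P])
qed

section \<open>Consequences of a polynomial right inverse\<close>

interpretation to_fract_hom: inj_comm_ring_hom to_fract by unfold_locales auto
interpretation to_fract_hom: inj_idom_hom to_fract ..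

lemma rank_eq_dim_row_if_right_inverse:
  assumes A: "A \<in> carrier_mat m n" and X: "X \<in> carrier_mat n m" and AX: "A * X = 1\<^sub>m m"
  shows "vec_space.rank m (A :: 'a :: field mat) = m"
proof -
  interpret vec_space "TYPE('a)" m .
  have "span (set (cols A)) = carrier_vec m"
  proof
    show "carrier_vec m \<subseteq> span (set (cols A))"
    proof
      fix y :: "'a vec" assume y: "y \<in> carrier_vec m"
      have "y = A *\<^sub>v (X *\<^sub>v y)"
        using assoc_mult_mat_vec[OF A X y] AX y by simp
      moreover have "X *\<^sub>v y \<in> carrier_vec n" using X y by simp
      ultimately have "\<exists>x\<in>carrier_vec (dim_col A). A *\<^sub>v x = y"
        using A by (intro bexI[of _ "X *\<^sub>v y"]) auto
      then have "y \<in> {y \<in> carrier_vec (dim_row A). \<exists>x\<in>carrier_vec (dim_col A). A *\<^sub>v x = y}"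
        using A y by simp
      then show "y \<in> span (set (cols A))"
        unfolding col_space_eq[OF A, symmetric] col_space_def .
    qed
    show "span (set (cols A)) \<subseteq> carrier_vec m"
      using A cols_dim[of A] by (intro span_is_subset2) auto
  qed
  then have "span_vs (set (cols A)) = V" by (simp add: module_vec_def)
  then show ?thesis by (simp add: rank_def dim_is_n)
qed

lemma normal_rank_if_right_inverse:
  assumes P: "P \<in> carrier_mat m n" and X: "X \<in> carrier_mat n m" and PX: "P * X = 1\<^sub>m m"
  shows "normal_rank P = m"
proof -
  have "rat_mat P * rat_mat X = rat_mat (P * X)"
    by (rule to_fract_hom.mat_hom_mult[OF P X, symmetric])
  also have "\<dots> = 1\<^sub>m m" unfolding PX by (rule to_fract_hom.mat_hom_one)
  finally show ?thesis
    unfolding normal_rank_def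
    using rank_eq_dim_row_if_right_inverse[of "rat_mat P" m n "rat_mat X"] P X by simp
qed

text \<open>If \<open>U P V = D\<close> with \<open>U\<close> and \<open>V\<close> unimodular, then
  \<open>D\<close> times \<open>adj V * X * adj U\<close> is a nonzero constant multiple of the
  identity. Each diagonal entry of \<open>D\<close> therefore divides a nonzero constant, and being
  monic it is 1. Adjugates take the place of inverses, which keeps everything over the
  polynomials.\<close>

lemma smith_form_if_right_inverse:
  assumes P: "P \<in> carrier_mat m n" and X: "X \<in> carrier_mat n m" and PX: "P * X = 1\<^sub>m m"
    and gs: "smith_form P gs"
  shows "gs = replicate m 1"
proof (rule replicate_eqI)
  show len: "length gs = m"
    using gs normal_rank_if_right_inverse[OF P X PX] by (simp add: smith_form_def)
  fix g assume "g \<in> set gs"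
  then obtain i where i: "i < m" "g = gs ! i" by (auto simp: in_set_conv_nth len)
  have monic: "lead_coeff g = 1" using gs \<open>g \<in> set gs\<close> by (simp add: smith_form_def)
  let ?D = "mat m n (\<lambda>(i, j). if i = j \<and> i < length gs then gs ! i else 0)"
  obtain U V a b where U: "U \<in> carrier_mat m m" "a \<noteq> 0" "det U = [:a:]"
    and V: "V \<in> carrier_mat n n" "b \<noteq> 0" "det V = [:b:]" and D: "U * P * V = ?D"
    using gs P unfolding smith_form_def by (auto simp: carrier_matD[OF P])
  note adjU = adj_mat[OF U(1)] and adjV = adj_mat[OF V(1)]
  define Y where "Y = adj_mat V * (X * adj_mat U)"
  have XU: "X * adj_mat U \<in> carrier_mat n m" using X adjU by simp
  have Y: "Y \<in> carrier_mat n m" unfolding Y_def using XU adjV by simp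
  have UP: "U * P \<in> carrier_mat m n" using U P by simp
  have "?D * Y = (U * P) * (V * Y)"
    unfolding D[symmetric] by (rule assoc_mult_mat[OF UP V(1) Y])
  also have "V * Y = det V \<cdot>\<^sub>m (X * adj_mat U)"
    unfolding Y_def assoc_mult_mat[OF V(1) adjV(1) XU, symmetric] adjV(2)
    using XU by (simp add: mult_smult_assoc_mat[OF one_carrier_mat XU] left_mult_one_mat[OF XU])
  also have "(U * P) * (det V \<cdot>\<^sub>m (X * adj_mat U)) = det V \<cdot>\<^sub>m ((U * P) * (X * adj_mat U))"
    by (rule mult_smult_distrib[OF UP XU])
  also have "(U * P) * (X * adj_mat U) = U * (P * (X * adj_mat U))"
    by (rule assoc_mult_mat[OF U(1) P XU])
  also have "P * (X * adj_mat U) = adj_mat U"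
    unfolding assoc_mult_mat[OF P X adjU(1), symmetric] PX using adjU(1) by simp
  also have "U * adj_mat U = det U \<cdot>\<^sub>m 1\<^sub>m m" by (rule adjU(2))
  finally have ii: "(?D * Y) $$ (i, i) = [:b * a:]"
    using i by (simp add: U V)
  have "(?D * Y) $$ (i, i) = g * Y $$ (i, i)"
  proof (cases "i < n")
    case True
    have "(?D * Y) $$ (i, i) = (\<Sum>k<n. (if i = k then g else 0) * Y $$ (k, i))"
      using i Y by (auto simp: scalar_prod_def atLeast0LessThan len intro!: sum.cong)
    also have "\<dots> = (\<Sum>k<n. if k = i then g * Y $$ (k, i) else 0)" by (rule sum.cong) auto
    finally show ?thesis using True by simp
  next
    \<comment> \<open>Row \<open>i\<close> of \<open>?D\<close> would vanish, although its product
      with \<open>Y\<close> has a nonzero diagonal entry.\<close>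
    case False
    have "(?D * Y) $$ (i, i) = (\<Sum>k<n. (if i = k then g else 0) * Y $$ (k, i))"
      using i Y by (auto simp: scalar_prod_def atLeast0LessThan len intro!: sum.cong)
    also have "\<dots> = 0" using False by (intro sum.neutral) auto
    finally show ?thesis using U(2) V(2) ii by simp
  qed
  with ii have "g dvd [:b * a:]" by (metis dvd_triv_left)
  then have "degree g \<le> degree [:b * a:]" using U(2) V(2) by (intro dvd_imp_degree_le) auto
  then have "degree g = 0" by simp
  then obtain k where "g = [:k:]" by (rule degree_eq_zeroE)
  with monic show "g = 1" by (simp add: one_pCons)
qed

text \<open>The existence half: the right inverse makes the rank \<open>m\<close>, and column
  operations alone reach the Smith form, so the row factor is the identity.\<close>

lemma smith_form_replicate_1:
  assumes P: "P \<in> carrier_mat m n" and X: "X \<in> carrier_mat n m" and PX: "P * X = 1\<^sub>m m"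
    and V: "V \<in> carrier_mat n n" "c \<noteq> 0" "det V = [:c:]"
    and PV: "P * V = mat m n (\<lambda>(i, j). if i = j then 1 else 0)"
  shows "smith_form P (replicate m 1)"
proof -
  have "1\<^sub>m m * P * V = mat m n (\<lambda>(i, j). if i = j \<and> i < m then replicate m 1 ! i else 0)"
    using P PV by (auto intro!: eq_matI)
  then show ?thesis
    unfolding smith_form_def normal_rank_if_right_inverse[OF P X PX] carrier_matD[OF P] length_replicate
    using V by (intro conjI exI[of _ "1\<^sub>m m"] exI[of _ V] exI[of _ 1] exI[of _ c])
      (auto simp: one_pCons)
qed

lemma invariant_polys_replicate_1:
  assumes P: "P \<in> carrier_mat m n" and X: "X \<in> carrier_mat n m" and PX: "P * X = 1\<^sub>m m"
    and V: "V \<in> carrier_mat n n" "c \<noteq> 0" "det V = [:c:]"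
    and PV: "P * V = mat m n (\<lambda>(i, j). if i = j then 1 else 0)"
  shows "invariant_polys P = replicate m 1"
  unfolding invariant_polys_def
  using smith_form_replicate_1[OF assms] smith_form_if_right_inverse[OF P X PX] by blast

text \<open>Multiplying \<open>y P = 0\<close> by the right inverse gives \<open>y = 0\<close>. The
  zero space has the empty set as its only polynomial basis, because a basis contains no zero
  vector.\<close>

lemma left_minimal_indices_Nil:
  assumes P: "P \<in> carrier_mat m n" and X: "X \<in> carrier_mat n m" and PX: "P * X = 1\<^sub>m m"
  shows "left_minimal_indices P = []"
proof -
  interpret vec_space "TYPE(complex poly fract)" m .
  let ?V = "{y \<in> carrier_vec m. mat_of_rows m [y] * rat_mat P = 0\<^sub>m 1 n}"
  have RX: "rat_mat P * rat_mat X = 1\<^sub>m m"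
    unfolding to_fract_hom.mat_hom_mult[OF P X, symmetric] PX by (rule to_fract_hom.mat_hom_one)
  have V: "?V = {0\<^sub>v m}"
  proof (intro equalityI subsetI)
    fix y assume y: "y \<in> ?V"
    have yc: "mat_of_rows m [y] \<in> carrier_mat 1 m" by (auto simp: mat_of_rows_def)
    have "mat_of_rows m [y] = mat_of_rows m [y] * (rat_mat P * rat_mat X)"
      unfolding RX using yc by simp
    also have "\<dots> = (mat_of_rows m [y] * rat_mat P) * rat_mat X"
      by (rule assoc_mult_mat[symmetric, OF yc]) (use P X in auto)
    also have "\<dots> = 0\<^sub>m 1 m" using y X by simp
    finally have "mat_of_rows m [y] $$ (0, j) = 0" if "j < m" for j using that by simp
    then have "y = 0\<^sub>v m" using y by (auto simp: mat_of_rows_def intro!: eq_vecI)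
    then show "y \<in> {0\<^sub>v m}" by simp
  next
    fix y :: "complex poly fract vec" assume "y \<in> {0\<^sub>v m}"
    then show "y \<in> ?V"
      using P by (auto simp: mat_of_rows_def scalar_prod_def intro!: eq_matI)
  qed
  have sub: "submodule class_ring {0\<^sub>v m} V"
    using span_is_submodule[of "{}"] by (simp add: span_empty)
  interpret Z: vectorspace class_ring "V\<lparr>carrier := {0\<^sub>v m}\<rparr>"
    using submodule_is_module[OF sub] class_field by (intro vectorspace.intro)
  have basis: "poly_basis m {0\<^sub>v m} B \<longleftrightarrow> B = {}" for B
  proof
    assume B: "poly_basis m {0\<^sub>v m} B"
    show "B = {}"
    proof (rule ccontr)
      assume "B \<noteq> {}"
      then obtain b where b: "b \<in> B" by blast
      from B have "map_vec to_fract ` B \<subseteq> {0\<^sub>v m}" and ind: "Z.lin_indpt (map_vec to_fract ` B)"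
        unfolding poly_basis_def Z.basis_def by auto
      have "map_vec to_fract b \<in> {0\<^sub>v m}"
        by (rule subsetD[OF \<open>map_vec to_fract ` B \<subseteq> {0\<^sub>v m}\<close> imageI[OF b]])
      moreover have "map_vec to_fract b \<in> map_vec to_fract ` B" by (rule imageI[OF b])
      moreover have "0\<^sub>v m \<notin> map_vec to_fract ` B"
        using Z.vs_zero_lin_dep[OF _ ind] \<open>map_vec to_fract ` B \<subseteq> {0\<^sub>v m}\<close> by simp
      ultimately show False by (simp only: singleton_iff)
    qed
  next
    assume "B = {}"
    have "Z.lin_indpt {}" unfolding Z.lin_dep_def by blast
    then have "Z.basis {}" unfolding Z.basis_def Z.span_empty by simp
    then show "poly_basis m {0\<^sub>v m} B" unfolding poly_basis_def \<open>B = {}\<close> by simp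
  qed
  have minimal: "minimal_basis m {0\<^sub>v m} B \<longleftrightarrow> B = {}" for B
    unfolding minimal_basis_def basis by auto
  show ?thesis
    unfolding left_minimal_indices_def minimal_indices_def carrier_matD[OF P] V minimal
    by (rule the_equality) (simp_all only: simp_thms ex_simps sum.empty mset_set.empty
        image_mset_empty sorted_list_of_multiset_empty rev.simps)
qed

section \<open>Generators of the kernel\<close>

abbreviation lam :: "complex poly poly \<Rightarrow> complex poly poly" where
  "lam \<equiv> Polynomial.smult [:0, 1:]"

lemma coeff_lam: "coeff (coeff (lam x) j) e = (if e = 0 then 0 else coeff (coeff x j) (e - 1))"
  by (auto simp: coeff_pCons split: nat.split)

lemma lam_in_vpoly_iff: "lam x \<in> vpoly n (Suc k) \<longleftrightarrow> x \<in> vpoly n k"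
proof
  assume x: "lam x \<in> vpoly n (Suc k)"
  show "x \<in> vpoly n k"
  proof (rule vpolyI)
    fix j e assume "n \<le> j \<or> k \<le> e"
    then have "coeff (coeff (lam x) j) (Suc e) = 0" by (intro vpoly_coeff[OF x]) auto
    then show "coeff (coeff x j) e = 0" by (simp add: coeff_lam)
  qed
next
  assume x: "x \<in> vpoly n k"
  show "lam x \<in> vpoly n (Suc k)"
    by (rule vpolyI) (simp only: coeff_lam, auto intro!: vpoly_coeff[OF x])
qed

lemma lam_0_iff [simp]: "lam x = 0 \<longleftrightarrow> x = 0"
  by simp

lemma linear_lam: "Vector_Spaces.linear cscale cscale lam"
  unfolding Vector_Spaces.linear_iff
  by (simp add: cvec.vector_space_axioms smult_add_right mult.commute)

text \<open>Since the bound in \<open>vpoly\<close> is strict, \<open>mker P (Suc a)\<close>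
  consists of the kernel vectors of degree at most \<open>a\<close>.\<close>

definition mker :: "complex poly mat \<Rightarrow> nat \<Rightarrow> complex poly poly set" where
  "mker P k = {x \<in> vpoly (dim_col P) k. act P x = 0}"

lemma subspace_mker: "cvec.subspace (mker P k)"
proof -
  interpret a: Vector_Spaces.linear cscale cscale "act P" by (rule linear_act)
  show ?thesis
    using subspace_vpoly[of "dim_col P" k]
    by (auto simp: mker_def cvec.subspace_def a.add a.scale a.zero)
qed

lemma mker_mono: "k \<le> k' \<Longrightarrow> mker P k \<subseteq> mker P k'"
  using vpoly_mono[of "dim_col P" "dim_col P" k k'] by (auto simp: mker_def)

lemma lam_mker_iff: "lam x \<in> mker P (Suc k) \<longleftrightarrow> x \<in> mker P k"
  by (simp add: mker_def lam_in_vpoly_iff act_smult)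

lemma dim_mker:
  assumes P: "P \<in> POL d m n" and surj: "vpoly m (k + d) \<subseteq> act P ` vpoly n k"
  shows "n * k = cvec.dim (mker P k) + m * (k + d)"
proof -
  have "act P ` vpoly n k = vpoly m (k + d)"
    using surj act_in_vpoly[OF P] by blast
  then show ?thesis
    using cvec.rank_nullity_on[OF linear_act subspace_vpoly finite_vbasis vpoly_subset_span,
        of n k P] P
    by (simp add: dim_vpoly mker_def dim_POL)
qed

text \<open>Write \<open>y = y0 + \<lambda> y1\<close> with \<open>y0\<close> constant. Both parts
  lie in the smaller target space, \<open>y0\<close> because \<open>0 < k\<close>, and
  multiplication by \<lambda> commutes with the action of \<open>P\<close>.\<close>

lemma surj_Suc:
  assumes P: "P \<in> POL d m n" and surj: "vpoly m (k + d) \<subseteq> act P ` vpoly n k" and "0 < k"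
  shows "vpoly m (Suc k + d) \<subseteq> act P ` vpoly n (Suc k)"
proof
  interpret a: Vector_Spaces.linear cscale cscale "act P" by (rule linear_act)
  fix y assume y: "y \<in> vpoly m (Suc k + d)"
  define y0 where "y0 = vec_of m (\<lambda>i. [:coeff (coeff y i) 0:])"
  define y1 where "y1 = vec_of m (\<lambda>i. poly_shift 1 (coeff y i))"
  have "y0 \<in> vpoly m (k + d)"
    using \<open>0 < k\<close> by (auto intro!: vpolyI simp: y0_def coeff_pCons split: nat.split)
  moreover have "y1 \<in> vpoly m (k + d)"
    by (rule vpolyI) (auto simp: y1_def coeff_poly_shift intro!: vpoly_coeff[OF y])
  ultimately obtain x0 x1 where x: "x0 \<in> vpoly n k" "y0 = act P x0" "x1 \<in> vpoly n k" "y1 = act P x1"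
    using surj by (meson imageE subsetD)
  have "y = y0 + lam y1"
  proof (rule coeff2_eqI)
    fix j e
    have "coeff (coeff y j) e = 0" if "\<not> j < m" using that by (intro vpoly_coeff[OF y]) simp
    then show "coeff (coeff y j) e = coeff (coeff (y0 + lam y1) j) e"
      by (auto simp: y0_def y1_def coeff_lam coeff_poly_shift coeff_pCons simp del: coeff_smult split: nat.split)
  qed
  also have "\<dots> = act P (x0 + lam x1)" unfolding x(2,4) a.add act_smult ..
  finally have "y = act P (x0 + lam x1)" .
  moreover have "x0 + lam x1 \<in> vpoly n (Suc k)"
    using x(1,3) vpoly_mono[of n n k "Suc k"] lam_in_vpoly_iff[of x1 n k]
    by (intro cvec.subspace_add[OF subspace_vpoly]) auto
  ultimately show "y \<in> act P ` vpoly n (Suc k)" by (rule image_eqI)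
qed

text \<open>The parameter \<open>a\<close> will be the floor of \<open>md/(n - m)\<close>. Then
  \<open>n a <= m (a + d)\<close> and \<open>n (a + 1) >= m (a + 1 + d)\<close>, so the dimensions
  permit injectivity at the one bound and surjectivity at the next.\<close>

definition full_rank_at :: "nat \<Rightarrow> nat \<Rightarrow> nat \<Rightarrow> nat \<Rightarrow> complex poly mat \<Rightarrow> bool" where
  "full_rank_at d m n a P \<longleftrightarrow> P \<in> POL d m n \<and> (\<forall>x\<in>vpoly n a. act P x = 0 \<longrightarrow> x = 0) \<and>
     vpoly m (Suc a + d) \<subseteq> act P ` vpoly n (Suc a)"

text \<open>\<open>B\<close> is a basis of the kernel vectors of degree at most \<open>a\<close>. By injectivity \<open>B\<close> and \<open>\<lambda>B\<close> are together
  independent, and \<open>W\<close> extends them to a basis of the kernel vectors of degree at most \<open>a + 1\<close>.\<close>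

lemma kernel_generators_exist:
  assumes full: "full_rank_at d m n a P" and "m < n"
  obtains B W where "finite B" "finite W" "B \<inter> W = {}" "cvec.independent (B \<union> W)"
    "B \<subseteq> mker P (Suc a)" "W \<subseteq> mker P (Suc (Suc a))" "mker P (Suc a) \<subseteq> cvec.span B"
    "n * Suc a = card B + m * (Suc a + d)" "card B + card W = n - m"
    "\<forall>z\<in>mker P (Suc a). lam z \<in> cvec.span (B \<union> W) \<longrightarrow> z = 0"
proof -
  interpret l: Vector_Spaces.linear cscale cscale lam by (rule linear_lam)
  from full have P: "P \<in> POL d m n" and inj: "\<And>x. x \<in> mker P a \<Longrightarrow> x = 0"
    and surj: "vpoly m (Suc a + d) \<subseteq> act P ` vpoly n (Suc a)"
    by (auto simp: full_rank_at_def mker_def dim_POL)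
  let ?M1 = "mker P (Suc a)" and ?M2 = "mker P (Suc (Suc a))"
  have fin: "finite C" if "C \<subseteq> mker P k" "cvec.independent C" for C k
    using that cvec.independent_span_bound[OF finite_vbasis that(2), of n k] vpoly_subset_span[of n k] P
    by (force simp: mker_def dim_POL)
  obtain B where B: "B \<subseteq> ?M1" "cvec.independent B" "?M1 \<subseteq> cvec.span B" "card B = cvec.dim ?M1"
    by (rule cvec.basis_exists)
  have finB: "finite B" using B by (intro fin)
  have spanB: "cvec.span B \<subseteq> ?M1" using B(1) subspace_mker by (rule cvec.span_minimal)
  have injl: "inj_on lam B" by (rule inj_onI) (metis l.diff lam_0_iff right_minus_eq)
  have indl: "cvec.independent (lam ` B)"
  proof (rule cvec.independent_if_scalars_zero)
    fix g y assume *: "(\<Sum>x\<in>lam ` B. cscale (g x) x) = 0" "y \<in> lam ` B"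
    have "lam (\<Sum>x\<in>B. cscale (g (lam x)) x) = (\<Sum>x\<in>lam ` B. cscale (g x) x)"
      unfolding sum.reindex[OF injl] by (simp add: l.sum l.scale o_def del: smult_smult)
    then have sum: "(\<Sum>x\<in>B. cscale (g (lam x)) x) = 0" using *(1) by (simp only: lam_0_iff)
    obtain x where x: "x \<in> B" "y = lam x" using *(2) by (rule imageE)
    show "g y = 0"
      unfolding x(2) by (rule cvec.independentD[OF B(2) finB subset_refl sum x(1)])
  qed (use finB in simp)
  have spanl: "cvec.span (lam ` B) = lam ` cvec.span B" by (rule l.span_image)
  \<comment> \<open>A common element is \<lambda>z of degree at most \<open>a\<close>, so
    \<open>z\<close> has degree below \<open>a\<close> and is zero by injectivity.\<close>
  have Int: "x = 0" if x: "x \<in> cvec.span B" "x \<in> cvec.span (lam ` B)" for x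
  proof -
    obtain z where z: "z \<in> cvec.span B" "x = lam z" using x(2) unfolding spanl by (rule imageE)
    have "lam z \<in> ?M1" using x(1) spanB unfolding z(2) by (rule subsetD[rotated])
    then have "z \<in> mker P a" by (simp only: lam_mker_iff)
    then show "x = 0" using inj z(2) by simp
  qed
  have disj: "B \<inter> lam ` B = {}" and ind: "cvec.independent (B \<union> lam ` B)"
    using cvec.independent_Un[OF finB _ B(2) indl Int] finB by simp_all
  have "lam ` B \<subseteq> ?M2" using B(1) by (auto simp: lam_mker_iff)
  moreover have "B \<subseteq> ?M2" using B(1) mker_mono[of "Suc a" "Suc (Suc a)" P] by auto
  ultimately have sub: "B \<union> lam ` B \<subseteq> ?M2" by simp
  obtain C where C: "B \<union> lam ` B \<subseteq> C" "C \<subseteq> ?M2" "cvec.independent C" "?M2 \<subseteq> cvec.span C"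
    by (rule cvec.maximal_independent_subset_extend[OF sub ind])
  have finC: "finite C" using C by (intro fin)
  define W where "W = C - (B \<union> lam ` B)"
  show ?thesis
  proof (rule that[of B W])
    show "finite B" "finite W" "B \<inter> W = {}" using finB finC by (auto simp: W_def)
    show "cvec.independent (B \<union> W)"
      by (rule cvec.independent_mono[OF C(3)]) (use C(1) in \<open>auto simp: W_def\<close>)
    show "B \<subseteq> ?M1" "?M1 \<subseteq> cvec.span B" by fact+
    show "W \<subseteq> ?M2" using C(2) by (auto simp: W_def)
    show cB: "n * Suc a = card B + m * (Suc a + d)" unfolding B(4) by (rule dim_mker[OF P surj])
    \<comment> \<open>Subtracting the dimension formulas for the bounds \<open>Suc a\<close> and
      \<open>Suc (Suc a)\<close> gives \<open>card C - card B = n - m\<close>, and the copy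
      \<lambda>B inside \<open>C\<close> has as many elements as \<open>B\<close>.\<close>
    have "card C = cvec.dim ?M2" using C by (intro cvec.basis_card_eq_dim)
    then have "n * Suc (Suc a) = card C + m * (Suc (Suc a) + d)"
      using dim_mker[OF P surj_Suc[OF P surj]] by simp
    moreover have "card C = card (B \<union> lam ` B) + card W"
      unfolding W_def using C(1) finC
      by (metis card_Diff_subset card_mono finite_subset le_add_diff_inverse)
    moreover have "card (B \<union> lam ` B) = card B + card B"
      using finB disj by (simp add: card_Un_disjoint card_image[OF injl])
    ultimately show "card B + card W = n - m" using cB \<open>m < n\<close> by (simp add: algebra_simps)
    show "\<forall>z\<in>?M1. lam z \<in> cvec.span (B \<union> W) \<longrightarrow> z = 0"
    proof (intro ballI impI)
      fix z assume z: "z \<in> ?M1" "lam z \<in> cvec.span (B \<union> W)"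
      \<comment> \<open>\<lambda>z lies in the spans of two disjoint parts of the independent set
        \<open>C\<close>, namely \<lambda>B and \<open>B \<union> W\<close>.\<close>
      have "lam z \<in> cvec.span (lam ` B)" using z(1) B(3) unfolding spanl by auto
      moreover have "(B \<union> W) \<inter> lam ` B = {}" using disj by (auto simp: W_def)
      moreover have "cvec.independent (B \<union> W \<union> lam ` B)"
        by (rule cvec.independent_mono[OF C(3)]) (use C(1) in \<open>auto simp: W_def\<close>)
      ultimately have "lam z = 0"
        using cvec.span_Int_independent[of "B \<union> W" "lam ` B" "lam z"] z(2) finB finC
        by (simp add: W_def)
      then show "z = 0" by simp
    qed
  qed
qed

section \<open>Completing a right inverse to a unimodular matrix\<close>

definition cols_mat :: "nat \<Rightarrow> nat \<Rightarrow> (nat \<Rightarrow> complex poly poly) \<Rightarrow> complex poly mat" where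
  "cols_mat n l f = mat n l (\<lambda>(i, j). coeff (f j) i)"

lemma cols_mat_carrier [simp]: "cols_mat n l f \<in> carrier_mat n l"
  by (simp add: cols_mat_def)

lemma mult_cols_mat:
  assumes "P \<in> carrier_mat m n"
  shows "P * cols_mat n l f = mat m l (\<lambda>(i, j). coeff (act P (f j)) i)"
  using assms
  by (intro eq_matI) (auto simp: cols_mat_def coeff_act scalar_prod_def atLeast0LessThan intro!: sum.cong)

lemma smult_root_factor:
  "Polynomial.smult [:- c, 1:] x = lam x - cscale c x"
proof -
  have "[:- c, 1:] = [:0, 1:] - [:c:]" by simp
  then show ?thesis by (simp only: smult_diff_left)
qed

text \<open>Each entry is divisible by \<lambda> - c. Division lowers the degree bound by one; for
  \<open>k = 0\<close> the entries are constants with a root, hence zero.\<close>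

lemma vpoly_divide_root:
  assumes x: "x \<in> vpoly n (Suc k)" and root: "\<And>i. i < n \<Longrightarrow> poly (coeff x i) c = 0"
  obtains z where "z \<in> vpoly n k" "x = Polynomial.smult [:- c, 1:] z"
proof -
  have "\<exists>q. coeff x i = [:- c, 1:] * q" if "i < n" for i
    using root[OF that] by (simp add: poly_eq_0_iff_dvd dvd_def)
  then obtain q where q: "\<And>i. i < n \<Longrightarrow> coeff x i = [:- c, 1:] * q i" by metis
  let ?z = "vec_of n q"
  have "?z \<in> vpoly n k"
  proof (cases k)
    case 0
    have "q i = 0" if "i < n" for i
    proof (rule ccontr)
      assume "q i \<noteq> 0"
      then have "degree (coeff x i) = Suc (degree (q i))"
        unfolding q[OF that] by (subst degree_mult_eq) auto
      then show False using x by (simp add: vpoly_Suc_iff 0)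
    qed
    then show ?thesis by (auto intro!: vpolyI)
  next
    case (Suc k')
    have "degree (q i) \<le> k'" if "i < n" for i
    proof (cases "q i = 0")
      case False
      then have "degree (coeff x i) = Suc (degree (q i))"
        unfolding q[OF that] by (subst degree_mult_eq) auto
      moreover have "degree (coeff x i) \<le> k" using x by (simp add: vpoly_Suc_iff)
      ultimately show ?thesis using Suc by simp
    qed simp
    then show ?thesis by (simp add: Suc vpoly_Suc_iff)
  qed
  moreover have "x = Polynomial.smult [:- c, 1:] ?z"
    by (intro poly_eqI) (use q vpoly_coeff_zero[OF x] in auto)
  ultimately show ?thesis by (rule that)
qed

text \<open>If a constant combination of the columns vanishes at a point \<open>c\<close>, it is \<open>(\<lambda> - c) z\<close> for a kernel vector
  \<open>z\<close> of degree at most \<open>a\<close>, and then \<open>\<lambda>z\<close> lies in the span of \<open>B \<union> W\<close>.\<close>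

lemma completion_unimodular:
  assumes full: "full_rank_at d m n a P" and "m < n"
    and fin: "finite B" "finite W" and disj: "B \<inter> W = {}" and ind: "cvec.independent (B \<union> W)"
    and B: "B \<subseteq> mker P (Suc a)" and W: "W \<subseteq> mker P (Suc (Suc a))" and span: "mker P (Suc a) \<subseteq> cvec.span B"
    and key: "\<And>z. z \<in> mker P (Suc a) \<Longrightarrow> lam z \<in> cvec.span (B \<union> W) \<Longrightarrow> z = 0"
    and X: "\<And>i. i < m \<Longrightarrow> X i \<in> vpoly n (Suc a)" "\<And>i. i < m \<Longrightarrow> act P (X i) = vmon i 0"
    and N: "bij_betw N {m..<n} (B \<union> W)"
  defines "V \<equiv> cols_mat n n (\<lambda>j. if j < m then X j else N j)"
  shows "P * V = mat m n (\<lambda>(i, j). if i = j then 1 else 0)" "\<exists>c. c \<noteq> 0 \<and> det V = [:c:]"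
proof -
  interpret act: Vector_Spaces.linear cscale cscale "act P" by (rule linear_act)
  from full have P: "P \<in> POL d m n" by (simp add: full_rank_at_def)
  then have Pc: "P \<in> carrier_mat m n" by (simp add: POL_def)
  let ?L = "\<lambda>j. if j < m then X j else N j"
  have BW: "B \<union> W \<subseteq> mker P (Suc (Suc a))"
    using B W mker_mono[of "Suc a" "Suc (Suc a)" P] by auto
  have Nker: "N j \<in> mker P (Suc (Suc a))" if "m \<le> j" "j < n" for j
    using bij_betw_apply[OF N, of j] that BW by auto
  then have actN: "act P (N j) = 0" "N j \<in> vpoly n (Suc (Suc a))" if "m \<le> j" "j < n" for j
    using that by (auto simp: mker_def dim_POL[OF P])
  show "P * V = mat m n (\<lambda>(i, j). if i = j then 1 else 0)"
    unfolding V_def mult_cols_mat[OF Pc]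
    by (intro eq_matI) (auto simp: X actN vmon_def)
  \<comment> \<open>A complex polynomial without roots is a nonzero constant, so it suffices that
    \<open>V\<close> is nonsingular at every point.\<close>
  have "poly (det V) c \<noteq> 0" for c
  proof
    interpret ev: comm_ring_hom "\<lambda>p. poly p c" by unfold_locales auto
    assume det: "poly (det V) c = 0"
    let ?V = "map_mat (\<lambda>p. poly p c) V"
    have "det ?V = 0" using det by (simp add: ev.hom_det)
    moreover have "?V \<in> carrier_mat n n" by (simp add: V_def)
    ultimately obtain u where u: "u \<in> carrier_vec n" "u \<noteq> 0\<^sub>v n" "?V *\<^sub>v u = 0\<^sub>v n"
      using det_0_iff_vec_prod_zero by blast
    \<comment> \<open>A null vector \<open>u\<close> of \<open>V(c)\<close> yields a constant
      combination \<open>?u\<close> of the columns of \<open>V\<close> that vanishes at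
      \<open>c\<close>.\<close>
    let ?u = "\<Sum>j<n. cscale (u $ j) (?L j)"
    have "poly (coeff ?u i) c = (?V *\<^sub>v u) $ i" if "i < n" for i
      using that u(1)
      by (simp add: coeff_sum poly_sum scalar_prod_def V_def cols_mat_def atLeast0LessThan mult.commute)
    then have root: "poly (coeff ?u i) c = 0" if "i < n" for i using that u(3) by simp
    have "X j \<in> vpoly n (Suc (Suc a))" if "j < m" for j
      using X(1)[OF that] vpoly_mono[of n n "Suc a" "Suc (Suc a)"] by auto
    then have uv: "?u \<in> vpoly n (Suc (Suc a))"
      by (intro cvec.subspace_sum[OF subspace_vpoly] cvec.subspace_scale[OF subspace_vpoly])
        (auto simp: actN)
    have "act P ?u = (\<Sum>j<n. cscale (u $ j) (if j < m then vmon j 0 else 0))"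
      unfolding act.sum act.scale by (rule sum.cong) (auto simp: X actN)
    also have "\<dots> = (\<Sum>j<m. cscale (u $ j) (vmon j 0))"
      using \<open>m < n\<close> by (intro sum.mono_neutral_cong_right) auto
    finally have actu: "act P ?u = (\<Sum>j<m. cscale (u $ j) (vmon j 0))" .
    \<comment> \<open>\<open>act P ?u\<close> is the constant vector of the first \<open>m\<close>
      coefficients, and it vanishes at \<open>c\<close> because \<open>?u\<close> does.\<close>
    have u0: "u $ i = 0" if "i < m" for i
    proof -
      have "u $ i = poly (coeff (act P ?u) i) c"
        unfolding actu using that
        by (simp add: coeff_sum poly_sum vmon_def if_distrib[of "\<lambda>x. poly x _"]
            if_distrib[of "\<lambda>x. _ * x"] cong: if_cong)
      also have "\<dots> = 0"
        using Pc by (simp add: coeff_act poly_sum root)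
      finally show ?thesis .
    qed
    have acteq: "act P ?u = 0" unfolding actu using u0 by simp
    have "?u = (\<Sum>j\<in>{m..<n}. cscale (u $ j) (N j))"
      using u0 by (intro sum.mono_neutral_cong_right) auto
    also have "\<dots> = (\<Sum>b\<in>B \<union> W. cscale (u $ inv_into {m..<n} N b) b)"
      unfolding sum.reindex_bij_betw[OF N, symmetric]
      using N by (intro sum.cong) (auto simp: bij_betw_def inv_into_f_f)
    finally have usum: "?u = (\<Sum>b\<in>B \<union> W. cscale (u $ inv_into {m..<n} N b) b)" .
    obtain z where z: "z \<in> vpoly n (Suc a)" "?u = Polynomial.smult [:- c, 1:] z"
      by (rule vpoly_divide_root[OF uv root])
    have "Polynomial.smult [:- c, 1:] (act P z) = 0"
      using acteq unfolding z(2) act_smult .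
    then have zk: "z \<in> mker P (Suc a)" using z(1) by (simp add: mker_def dim_POL[OF P])
    \<comment> \<open>Here \<open>\<lambda>z = ?u + c z\<close>, and \<open>c z\<close> lies in the
      span of \<open>B\<close> since \<open>z\<close> is a kernel vector of degree at most
      \<open>a\<close>.\<close>
    have "?u \<in> cvec.span (B \<union> W)"
      unfolding usum by (intro cvec.span_sum cvec.span_scale cvec.span_base)
    moreover have "cscale c z \<in> cvec.span (B \<union> W)"
      using span zk cvec.span_mono[of B "B \<union> W"] by (intro cvec.span_scale) auto
    ultimately have "?u + cscale c z \<in> cvec.span (B \<union> W)" by (rule cvec.span_add)
    then have "lam z \<in> cvec.span (B \<union> W)" unfolding z(2) smult_root_factor by simp
    then have "z = 0" by (rule key[OF zk])
    then have "?u = 0" unfolding z(2) by simp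
    then have zero: "u $ inv_into {m..<n} N b = 0" if "b \<in> B \<union> W" for b
      using cvec.independentD[OF ind _ subset_refl _ that] fin unfolding usum by simp
    have "u $ j = 0" if "m \<le> j" "j < n" for j
      using zero[of "N j"] bij_betw_apply[OF N, of j] N that
      by (simp add: bij_betw_def inv_into_f_f)
    then have "u = 0\<^sub>v n" using u(1) u0 by (intro eq_vecI) (simp_all, metis not_le)
    then show False using u(2) by simp
  qed
  then show "\<exists>c. c \<noteq> 0 \<and> det V = [:c:]"
    using fundamental_theorem_of_algebra_alt[of "det V"] by auto
qed

section \<open>Minimal indices\<close>

text \<open>At most \<open>p\<close> of the \<open>p + q\<close> values equal \<open>a\<close> and
  every other is at least \<open>a + 1\<close>, which gives the lower bound. If it is attained,
  exactly \<open>p\<close> values are \<open>a\<close> and none exceeds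
  \<open>a + 1\<close>.\<close>

lemma degree_multiset_unique:
  fixes f :: "'a \<Rightarrow> nat"
  assumes fin: "finite B" and card: "card B = p + q" and ge: "\<And>b. b \<in> B \<Longrightarrow> a \<le> f b"
    and few: "card {b \<in> B. f b \<le> a} \<le> p"
  shows "p * a + q * Suc a \<le> sum f B"
    and "sum f B \<le> p * a + q * Suc a \<Longrightarrow>
      image_mset f (mset_set B) = replicate_mset p a + replicate_mset q (Suc a)"
proof -
  let ?S = "{b \<in> B. f b \<le> a}" and ?T = "{b \<in> B. \<not> f b \<le> a}"
  have BST: "B = ?S \<union> ?T" "?S \<inter> ?T = {}" by auto
  have cST: "card ?S + card ?T = p + q"
    using card_Un_disjoint[of ?S ?T] BST fin card by simp
  have "sum f B = sum f ?S + sum f ?T"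
    using sum.union_disjoint[of ?S ?T f] BST fin by simp
  moreover have "sum f ?S = sum (\<lambda>_. a) ?S"
    by (rule sum.cong) (use ge in \<open>auto intro: le_antisym\<close>)
  moreover have T: "card ?T * Suc a \<le> sum f ?T"
    using sum_mono[of ?T "\<lambda>_. Suc a" f] by simp
  ultimately have sum: "sum f B = card ?S * a + sum f ?T" by simp
  have total: "card ?S * a + card ?T * Suc a = (p + q) * a + card ?T"
    by (simp add: algebra_simps flip: cST)
  show lower: "p * a + q * Suc a \<le> sum f B"
    using sum T total few cST by (simp add: algebra_simps)
  assume upper: "sum f B \<le> p * a + q * Suc a"
  then have "card ?T \<le> q" using sum T total by (simp add: algebra_simps)
  then have cT: "card ?T = q" "card ?S = p" using few cST by auto
  have eqT: "sum f ?T = card ?T * Suc a"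
    using sum T upper cT by simp
  have "f b = Suc a" if "b \<in> ?T" for b
  proof (rule ccontr)
    assume "f b \<noteq> Suc a"
    then have "Suc a < f b" using that by simp
    then have "sum (\<lambda>_. Suc a) ?T < sum f ?T"
      using that fin by (intro sum_strict_mono_ex1) auto
    then show False using eqT by simp
  qed
  then have "image_mset f (mset_set ?T) = image_mset (\<lambda>_. Suc a) (mset_set ?T)"
    using fin by (intro image_mset_cong) simp
  moreover have "image_mset f (mset_set ?S) = image_mset (\<lambda>_. a) (mset_set ?S)"
    using fin ge by (intro image_mset_cong) (simp add: le_antisym)
  moreover have "mset_set B = mset_set ?S + mset_set ?T"
    using mset_set_Union[of ?S ?T] BST fin by simp
  ultimately show "image_mset f (mset_set B) = replicate_mset p a + replicate_mset q (Suc a)"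
    by (simp add: cT image_mset_const_eq)
qed

lemma sorted_list_of_replicate_mset:
  "sorted_list_of_multiset (replicate_mset p a + replicate_mset q (Suc a)) =
    replicate p a @ replicate q (Suc a)"
proof -
  have "replicate_mset p a + replicate_mset q (Suc a) = mset (replicate p a @ replicate q (Suc a))"
    by simp
  moreover have "sorted (replicate p a @ replicate q (Suc a))" by (auto simp: sorted_append)
  ultimately show ?thesis by (simp only: sorted_list_of_multiset_mset sorted_sort_id)
qed

section \<open>Polynomial bases of the rational kernel\<close>

lemma vec_degree_le_iff:
  assumes "b \<in> carrier_vec n" "0 < n"
  shows "vec_degree b \<le> k \<longleftrightarrow> (\<forall>j<n. degree (b $ j) \<le> k)"
proof -
  have "degree ` set\<^sub>v b \<noteq> {}" "finite (degree ` set\<^sub>v b)"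
    using assms by (auto simp: vec_set_def)
  then show ?thesis using assms by (auto simp: vec_degree_def vec_set_def)
qed

lemma vec_of_in_vpoly:
  assumes "b \<in> carrier_vec n" "0 < n" "vec_degree b \<le> k"
  shows "vec_of n (\<lambda>j. b $ j) \<in> vpoly n (Suc k)"
  using assms by (auto simp: vpoly_Suc_iff vec_degree_le_iff)

lemma act_vec_of:
  assumes "P \<in> carrier_mat m n" "b \<in> carrier_vec n" "i < m"
  shows "coeff (act P (vec_of n (\<lambda>j. b $ j))) i = (P *\<^sub>v b) $ i"
  using assms by (auto simp: coeff_act scalar_prod_def atLeast0LessThan intro!: sum.cong)

lemma kernel_vec_in_mker:
  assumes P: "P \<in> carrier_mat m n" and b: "b \<in> carrier_vec n" "0 < n" "vec_degree b \<le> k"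
    and ker: "map_vec to_fract b \<in> mat_kernel (rat_mat P)"
  shows "vec_of n (\<lambda>j. b $ j) \<in> mker P (Suc k)"
proof -
  have "map_vec to_fract (P *\<^sub>v b) = rat_mat P *\<^sub>v map_vec to_fract b"
    by (rule to_fract_hom.mult_mat_vec_hom[OF P b(1)])
  also have "\<dots> = 0\<^sub>v m" using mat_kernelD[OF _ ker, of m n] P by simp
  finally have "P *\<^sub>v b = 0\<^sub>v m" by simp
  then have "act P (vec_of n (\<lambda>j. b $ j)) = 0"
    by (intro poly_eqI) (metis P act_vec_of assms(2) carrier_matD(1) coeff_0 coeff_act index_zero_vec(1))
  then show ?thesis using vec_of_in_vpoly[OF b] P by (simp add: mker_def)
qed

text \<open>A kernel vector of degree below \<open>a\<close> is zero and cannot belong to a basis.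
  The basis vectors of degree at most \<open>a\<close> are independent over the rational functions,
  hence over the complex numbers, and they lie in the span of \<open>C\<close>; so \<open>C\<close>
  bounds their number.\<close>

lemma poly_basis_degrees:
  assumes full: "full_rank_at d m n a P" and "m < n"
    and C: "finite C" "mker P (Suc a) \<subseteq> cvec.span C"
    and B: "poly_basis n (mat_kernel (rat_mat P)) B"
  shows "\<And>b. b \<in> B \<Longrightarrow> a \<le> vec_degree b" "card {b \<in> B. vec_degree b \<le> a} \<le> card C"
proof -
  from full have P: "P \<in> POL d m n" and inj: "\<And>x. x \<in> mker P a \<Longrightarrow> x = 0"
    by (auto simp: full_rank_at_def mker_def dim_POL)
  then have Pc: "P \<in> carrier_mat m n" by (simp add: POL_def)
  interpret kernel m n "rat_mat P" by unfold_locales (use Pc in simp)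
  let ?h = "map_vec to_fract :: complex poly vec \<Rightarrow> complex poly fract vec"
  let ?x = "\<lambda>b. vec_of n (\<lambda>j. b $ j)"
  from B have Bc: "B \<subseteq> carrier_vec n" and fin: "finite B" and "Ker.basis (?h ` B)"
    by (simp_all add: poly_basis_def)
  then have ind: "Ker.lin_indpt (?h ` B)" and ker: "?h ` B \<subseteq> mat_kernel (rat_mat P)"
    by (auto simp: Ker.basis_def)
  have ind': "NC.lin_indpt (?h ` B)" using ind lindep_same[OF ker] by simp
  show "a \<le> vec_degree b" if b: "b \<in> B" for b
  proof (rule ccontr)
    assume "\<not> a \<le> vec_degree b"
    then have less: "Suc (vec_degree b) \<le> a" by simp
    have bc: "b \<in> carrier_vec n" using b Bc by auto
    have "?x b \<in> mker P (Suc (vec_degree b))"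
      using kernel_vec_in_mker[OF Pc bc _ order_refl] b ker \<open>m < n\<close> by auto
    then have "?x b = 0" using inj mker_mono[OF less, of P] by auto
    then have "b $ j = 0" if "j < n" for j using that by (metis coeff_vec_of coeff_0)
    then have "b = 0\<^sub>v n" using bc by (intro eq_vecI) auto
    then have "0\<^sub>v n \<in> ?h ` B" using b by (intro image_eqI[of _ _ b]) (auto simp: to_fract_hom.vec_hom_zero)
    moreover have "0\<^sub>v n \<notin> ?h ` B" using Ker.vs_zero_lin_dep[OF ker ind] by simp
    ultimately show False by simp
  qed
  let ?S = "{b \<in> B. vec_degree b \<le> a}"
  have injx: "inj_on ?x ?S"
  proof (rule inj_onI)
    fix b b' assume "b \<in> ?S" "b' \<in> ?S" and eq: "?x b = ?x b'"
    then have c: "b \<in> carrier_vec n" "b' \<in> carrier_vec n" using Bc by auto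
    have "b $ j = b' $ j" if "j < n" for j
      using arg_cong[OF eq, of "\<lambda>x. coeff x j"] that by simp
    then show "b = b'" using c by (intro eq_vecI) auto
  qed
  have injh: "inj_on ?h ?S" by (rule inj_onI) (rule to_fract_hom.vec_hom_inj)
  have "cvec.independent (?x ` ?S)"
  proof (rule cvec.independent_if_scalars_zero)
    fix g y assume sum: "(\<Sum>x\<in>?x ` ?S. cscale (g x) x) = 0" and y: "y \<in> ?x ` ?S"
    then obtain b where b: "b \<in> ?S" "y = ?x b" by auto
    \<comment> \<open>The complex coefficients of a relation become constant rational functions,
      indexed by the images of the basis vectors.\<close>
    define c where "c = (\<lambda>v. to_fract [:g (?x (inv_into ?S ?h v)):])"
    have zero: "(\<Sum>b\<in>?S. cscale (g (?x b)) (?x b)) = 0"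
      using sum unfolding sum.reindex[OF injx] by (simp add: o_def)
    have hS: "?h ` ?S \<subseteq> carrier_vec n" using Bc by auto
    have "NC.lincomb c (?h ` ?S) = 0\<^sub>v n"
    proof (rule eq_vecI)
      fix i assume i: "i < dim_vec (0\<^sub>v n :: complex poly fract vec)"
      then have i: "i < n" by simp
      have "NC.lincomb c (?h ` ?S) $ i = (\<Sum>v\<in>?h ` ?S. c v * v $ i)"
        by (rule NC.lincomb_index[OF i hS])
      also have "\<dots> = (\<Sum>b\<in>?S. c (?h b) * ?h b $ i)"
        unfolding sum.reindex[OF injh] by simp
      also have "\<dots> = (\<Sum>b\<in>?S. to_fract ([:g (?x b):] * b $ i))"
      proof (rule sum.cong[OF refl])
        fix b assume b: "b \<in> ?S"
        then have "b \<in> carrier_vec n" using Bc by auto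
        then have "?h b $ i = to_fract (b $ i)" using i by simp
        moreover have "c (?h b) = to_fract [:g (?x b):]" unfolding c_def inv_into_f_f[OF injh b] ..
        ultimately show "c (?h b) * ?h b $ i = to_fract ([:g (?x b):] * b $ i)"
          by (simp only: to_fract_hom.hom_mult)
      qed
      also have "\<dots> = to_fract (\<Sum>b\<in>?S. [:g (?x b):] * b $ i)" by (rule to_fract_hom.hom_sum[symmetric])
      also have "(\<Sum>b\<in>?S. [:g (?x b):] * b $ i) = coeff (\<Sum>b\<in>?S. cscale (g (?x b)) (?x b)) i"
        using i by (simp add: coeff_sum)
      finally show "NC.lincomb c (?h ` ?S) $ i = 0\<^sub>v n $ i" unfolding zero using i by simp
    qed (use hS NC.lincomb_dim[of "?h ` ?S" c] fin in simp)
    moreover have "?h ` ?S \<subseteq> ?h ` B" by auto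
    ultimately have "c (?h b) = 0"
      using NC.lin_dep_crit[where A = "?h ` ?S" and S = "?h ` B" and a = c and v = "?h b"] ind' fin b(1) by auto
    then show "g y = 0" using b by (simp add: c_def inv_into_f_f[OF injh])
  qed (use fin in simp)
  moreover have "?x ` ?S \<subseteq> mker P (Suc a)"
    using kernel_vec_in_mker[OF Pc _ _, of _ a] ker Bc \<open>m < n\<close> by auto
  then have "?x ` ?S \<subseteq> cvec.span C" using C(2) by auto
  ultimately have "card (?x ` ?S) \<le> card C" using cvec.independent_span_bound[OF C(1)] by blast
  then show "card ?S \<le> card C" by (simp add: card_image[OF injx])
qed

text \<open>The columns of \<open>V\<close> are independent over the rational functions because
  \<open>det V\<close> is nonzero. A kernel vector is \<open>V c\<close> for some rational
  \<open>c\<close>, and \<open>P V = [I 0]\<close> makes the first \<open>m\<close> entries of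
  \<open>c\<close> zero, so the last \<open>n - m\<close> columns span the kernel.\<close>

lemma kernel_basis_from_completion:
  assumes P: "P \<in> carrier_mat m n" and "m < n"
    and ker: "\<And>j. m \<le> j \<Longrightarrow> j < n \<Longrightarrow> act P (N j) = 0"
    and V: "V = cols_mat n n (\<lambda>j. if j < m then X j else N j)" "det V \<noteq> 0"
    and PV: "P * V = mat m n (\<lambda>(i, j). if i = j then 1 else 0)"
  shows "poly_basis n (mat_kernel (rat_mat P)) ((\<lambda>j. vec n (coeff (N j))) ` {m..<n})" (is "poly_basis n _ ?D")
proof -
  interpret kernel m n "rat_mat P" by unfold_locales (use P in simp)
  let ?h = "map_vec to_fract :: complex poly vec \<Rightarrow> complex poly fract vec"
  have Vc: "V \<in> carrier_mat n n" unfolding V(1) by simp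
  let ?R = "rat_mat V" and ?P = "rat_mat P"
  have Rc: "?R \<in> carrier_mat n n" and Pc: "?P \<in> carrier_mat m n" using Vc P by auto
  have det: "det ?R \<noteq> 0" using V(2) by (simp add: to_fract_hom.hom_det)
  let ?N = "mat n (n - m) (\<lambda>(i, j). to_fract (coeff (N (m + j)) i))"
  have colN: "col ?N j = ?h (vec n (coeff (N (m + j))))" if "j < n - m" for j
    using that by (intro eq_vecI) auto
  have "set (cols ?N) = col ?N ` {..<n - m}"
    by (auto simp: cols_def atLeast0LessThan)
  also have "\<dots> = (\<lambda>j. ?h (vec n (coeff (N (m + j))))) ` {..<n - m}"
    by (rule image_cong) (auto simp: colN)
  also have "\<dots> = ?h ` ?D"
  proof -
    have "{m..<n} = (+) m ` {..<n - m}"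
      using \<open>m < n\<close> by (simp add: atLeast0LessThan[symmetric] image_add_atLeastLessThan)
    then show ?thesis by (simp add: image_image)
  qed
  finally have colsN: "set (cols ?N) = ?h ` ?D" .
  have colsR: "?h ` ?D \<subseteq> set (cols ?R)"
  proof
    fix v assume "v \<in> ?h ` ?D"
    then obtain j where j: "m \<le> j" "j < n" "v = ?h (vec n (coeff (N j)))" by auto
    then have "v = col ?R j"
      by (intro eq_vecI) (auto simp: V(1) cols_mat_def)
    then show "v \<in> set (cols ?R)" using j Vc by (auto simp: cols_def)
  qed
  have "\<not> NC.lin_dep (set (cols ?R))"
    using NC.lin_dep_cols_imp_det_0[OF Rc] det by auto
  then have "\<not> NC.lin_dep (?h ` ?D)"
    using NC.supset_ld_is_ld[OF _ colsR] by auto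
  moreover have sub: "?h ` ?D \<subseteq> mat_kernel ?P"
  proof
    fix v assume "v \<in> ?h ` ?D"
    then obtain j where j: "m \<le> j" "j < n" "v = ?h (vec n (coeff (N j)))" by auto
    have "P *\<^sub>v vec n (coeff (N j)) = 0\<^sub>v m"
    proof (rule eq_vecI)
      fix i assume "i < dim_vec (0\<^sub>v m :: complex poly vec)"
      then have i: "i < m" by simp
      have "(P *\<^sub>v vec n (coeff (N j))) $ i = coeff (act P (N j)) i"
        using P i by (auto simp: coeff_act scalar_prod_def atLeast0LessThan intro!: sum.cong)
      then show "(P *\<^sub>v vec n (coeff (N j))) $ i = 0\<^sub>v m $ i" using ker[OF j(1,2)] i by simp
    qed (use P in simp)
    then have "?P *\<^sub>v v = 0\<^sub>v m"
      unfolding j(3) using to_fract_hom.mult_mat_vec_hom[OF P, of "vec n (coeff (N j))"]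
      by (simp add: to_fract_hom.vec_hom_zero)
    moreover have "v \<in> carrier_vec n" using j(3) by simp
    ultimately show "v \<in> mat_kernel ?P" by (intro mat_kernelI[OF Pc])
  qed
  ultimately have ind: "\<not> Ker.lin_dep (?h ` ?D)" using lindep_same[OF sub] by simp
  have "mat_kernel ?P \<subseteq> NC.span (set (cols ?N))"
  proof
    fix v assume v: "v \<in> mat_kernel ?P"
    note vk = mat_kernelD[OF Pc v]
    note adj = adj_mat[OF Rc]
    \<comment> \<open>The adjugate divided by the determinant is the inverse of
      \<open>?R\<close>.\<close>
    define c where "c = inverse (det ?R) \<cdot>\<^sub>v (adj_mat ?R *\<^sub>v v)"
    have cc: "c \<in> carrier_vec n" unfolding c_def using adj vk by simp
    have "?R *\<^sub>v c = inverse (det ?R) \<cdot>\<^sub>v (?R *\<^sub>v (adj_mat ?R *\<^sub>v v))"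
      unfolding c_def by (rule mult_mat_vec[OF Rc]) (use adj vk in auto)
    also have "?R *\<^sub>v (adj_mat ?R *\<^sub>v v) = (det ?R \<cdot>\<^sub>m 1\<^sub>m n) *\<^sub>v v"
      using assoc_mult_mat_vec[OF Rc adj(1) vk(1)] adj(2) by simp
    also have "\<dots> = det ?R \<cdot>\<^sub>v v"
    proof (rule eq_vecI)
      fix i assume "i < dim_vec (det ?R \<cdot>\<^sub>v v)"
      then have i: "i < n" using vk(1) by simp
      have "((det ?R \<cdot>\<^sub>m 1\<^sub>m n) *\<^sub>v v) $ i = (\<Sum>j<n. if j = i then det ?R * v $ j else 0)"
        using i vk(1) by (simp add: scalar_prod_def atLeast0LessThan if_distrib[of "\<lambda>x. _ * x"]
            if_distrib[of "\<lambda>x. x * _"] cong: if_cong)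
      also have "\<dots> = (det ?R \<cdot>\<^sub>v v) $ i" using i vk(1) by simp
      finally show "((det ?R \<cdot>\<^sub>m 1\<^sub>m n) *\<^sub>v v) $ i = (det ?R \<cdot>\<^sub>v v) $ i" .
    qed (use vk(1) in simp)
    also have "inverse (det ?R) \<cdot>\<^sub>v (det ?R \<cdot>\<^sub>v v) = v"
      using det vk(1) by (simp add: smult_smult_assoc)
    finally have Rcv: "?R *\<^sub>v c = v" .
    have "?P * ?R = rat_mat (P * V)" by (rule to_fract_hom.mat_hom_mult[OF P Vc, symmetric])
    also have "\<dots> = mat m n (\<lambda>(i, j). if i = j then 1 else 0)"
      unfolding PV by (intro eq_matI) auto
    finally have PR: "?P * ?R = mat m n (\<lambda>(i, j). if i = j then 1 else 0)" .
    have "?P *\<^sub>v (?R *\<^sub>v c) = mat m n (\<lambda>(i, j). if i = j then 1 else 0) *\<^sub>v c"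
      unfolding assoc_mult_mat_vec[OF Pc Rc cc, symmetric] PR ..
    then have Ic: "mat m n (\<lambda>(i, j). if i = j then 1 else 0) *\<^sub>v c = 0\<^sub>v m"
      unfolding Rcv vk(2) ..
    have c0: "c $ i = 0" if i: "i < m" for i
    proof -
      have "0 = (mat m n (\<lambda>(i, j). if i = j then 1 else 0) *\<^sub>v c) $ i"
        unfolding Ic using i by simp
      also have "\<dots> = (\<Sum>j<n. if j = i then c $ j else 0)"
        using i cc \<open>m < n\<close> by (simp add: scalar_prod_def atLeast0LessThan if_distrib[of "\<lambda>x. x * _"] cong: if_cong)
      also have "\<dots> = c $ i" using i \<open>m < n\<close> by simp
      finally show ?thesis ..
    qed
    have "?N *\<^sub>v vec (n - m) (\<lambda>j. c $ (m + j)) = v"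
    proof (rule eq_vecI)
      fix i assume "i < dim_vec v"
      then have i: "i < n" using vk(1) by simp
      have "v $ i = (?R *\<^sub>v c) $ i" unfolding Rcv ..
      also have "\<dots> = (\<Sum>j = 0..<n. ?R $$ (i, j) * c $ j)"
        using i Vc cc by (simp add: scalar_prod_def)
      also have "\<dots> = (\<Sum>j = m..<n. ?R $$ (i, j) * c $ j)"
        using c0 by (intro sum.mono_neutral_right) auto
      also have "\<dots> = (\<Sum>j = 0..<n - m. ?R $$ (i, m + j) * c $ (m + j))"
        using \<open>m < n\<close> by (subst sum.atLeastLessThan_shift_0) (simp add: add.commute)
      also have "\<dots> = (?N *\<^sub>v vec (n - m) (\<lambda>j. c $ (m + j))) $ i"
        using i by (auto simp: scalar_prod_def V(1) cols_mat_def intro!: sum.cong)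
      finally show "(?N *\<^sub>v vec (n - m) (\<lambda>j. c $ (m + j))) $ i = v $ i" ..
    qed (use vk(1) in simp)
    then have "v \<in> {y \<in> carrier_vec (dim_row ?N). \<exists>x\<in>carrier_vec (dim_col ?N). ?N *\<^sub>v x = y}"
      using vk(1) by (auto intro!: bexI[of _ "vec (n - m) (\<lambda>j. c $ (m + j))"])
    then show "v \<in> NC.span (set (cols ?N))"
      unfolding NC.col_space_eq[of ?N "n - m", symmetric, simplified] NC.col_space_def
      using NC.col_space_eq[of ?N "n - m"] by (simp add: NC.col_space_def)
  qed
  then have "mat_kernel ?P \<subseteq> Ker.span (?h ` ?D)" unfolding colsN span_same[OF sub] .
  then have "Ker.span (?h ` ?D) = mat_kernel ?P"
    using Ker.span_is_subset2[OF sub] by auto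
  then have "Ker.basis (?h ` ?D)" unfolding Ker.basis_def using ind sub by simp
  then show ?thesis unfolding poly_basis_def by auto
qed

lemma poly_basis_card:
  assumes P: "P \<in> carrier_mat m n"
    and B: "poly_basis n (mat_kernel (rat_mat P)) B" and D: "poly_basis n (mat_kernel (rat_mat P)) D"
  shows "card B = card D"
proof -
  interpret kernel m n "rat_mat P" by unfold_locales (use P in simp)
  let ?h = "map_vec to_fract :: complex poly vec \<Rightarrow> complex poly fract vec"
  have inj: "inj_on ?h S" for S by (rule inj_onI) (rule to_fract_hom.vec_hom_inj)
  from B D have "finite (?h ` B)" "Ker.basis (?h ` B)" "finite (?h ` D)" "Ker.basis (?h ` D)"
    by (simp_all add: poly_basis_def)
  then have "card (?h ` B) = card (?h ` D)" using Ker.dim_basis by metis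
  then show ?thesis by (simp add: card_image[OF inj])
qed

text \<open>By rank-nullity, \<open>p\<close> is the dimension of the space of kernel vectors of
  degree at most \<open>a\<close>. The columns from \<open>B \<union> W\<close> have total degree at
  most \<open>p a + (n - m - p)(a + 1)\<close>, and counting shows that no polynomial basis of the
  kernel has less. So they form a minimal basis, and every minimal basis has this total and
  therefore the same degrees.\<close>

lemma full_rank_at_structure:
  assumes full: "full_rank_at d m n a P" and "m < n" and p: "n * Suc a = p + m * (Suc a + d)"
  shows "normal_rank P = m" "invariant_polys P = replicate m 1" "left_minimal_indices P = []"
    "p \<le> n - m" "right_minimal_indices P = replicate (n - m - p) (Suc a) @ replicate p a"
proof -
  from full have P: "P \<in> POL d m n" and surj: "vpoly m (Suc a + d) \<subseteq> act P ` vpoly n (Suc a)"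
    by (auto simp: full_rank_at_def)
  then have Pc: "P \<in> carrier_mat m n" by (simp add: POL_def)
  obtain B W where fin: "finite B" "finite W" and BW: "B \<inter> W = {}" "cvec.independent (B \<union> W)"
      "B \<subseteq> mker P (Suc a)" "W \<subseteq> mker P (Suc (Suc a))" "mker P (Suc a) \<subseteq> cvec.span B"
    and cB: "n * Suc a = card B + m * (Suc a + d)" and cBW: "card B + card W = n - m"
    and key: "\<forall>z\<in>mker P (Suc a). lam z \<in> cvec.span (B \<union> W) \<longrightarrow> z = 0"
    by (rule kernel_generators_exist[OF full \<open>m < n\<close>])
  have pB: "p = card B" using p cB by simp
  have qW: "n - m - p = card W" using cBW pB by simp
  show "p \<le> n - m" using cBW pB by simp
  have "\<exists>x. x \<in> vpoly n (Suc a) \<and> act P x = vmon i 0" if "i < m" for i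
  proof -
    have "vmon i 0 \<in> vpoly m (Suc a + d)" using that by (intro vmon_in_vpoly) auto
    then have "vmon i 0 \<in> act P ` vpoly n (Suc a)" by (rule subsetD[OF surj])
    then show ?thesis by auto
  qed
  then obtain X where X: "\<And>i. i < m \<Longrightarrow> X i \<in> vpoly n (Suc a)" "\<And>i. i < m \<Longrightarrow> act P (X i) = vmon i 0"
    by metis
  have "card (B \<union> W) = card {m..<n}" using cBW fin BW(1) by (simp add: card_Un_disjoint)
  then obtain N where N: "bij_betw N {m..<n} (B \<union> W)"
    using finite_same_card_bij[of "{m..<n}" "B \<union> W"] fin by auto
  define V where "V = cols_mat n n (\<lambda>j. if j < m then X j else N j)"
  have PV: "P * V = mat m n (\<lambda>(i, j). if i = j then 1 else 0)" and "\<exists>c. c \<noteq> 0 \<and> det V = [:c:]"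
    unfolding V_def by (rule completion_unimodular[OF full \<open>m < n\<close> fin BW key[rule_format] X N]; assumption)+
  then obtain c where c: "c \<noteq> 0" "det V = [:c:]" by auto
  have Vc: "V \<in> carrier_mat n n" by (simp add: V_def)
  have PX: "P * cols_mat n m X = 1\<^sub>m m"
    unfolding mult_cols_mat[OF Pc] by (intro eq_matI) (auto simp: X vmon_def)
  show "normal_rank P = m" by (rule normal_rank_if_right_inverse[OF Pc cols_mat_carrier PX])
  show "invariant_polys P = replicate m 1"
    by (rule invariant_polys_replicate_1[OF Pc cols_mat_carrier PX Vc c PV])
  show "left_minimal_indices P = []" by (rule left_minimal_indices_Nil[OF Pc cols_mat_carrier PX])
  let ?K = "mat_kernel (rat_mat P)"
  let ?v = "\<lambda>x. vec n (coeff x) :: complex poly vec"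
  have mono: "mker P (Suc a) \<subseteq> mker P (Suc (Suc a))" by (rule mker_mono) simp
  have BWk: "B \<union> W \<subseteq> mker P (Suc (Suc a))" using BW(3,4) mono by auto
  have NBW: "N ` {m..<n} = B \<union> W" using N by (simp add: bij_betw_def)
  have "act P (N j) = 0" if "m \<le> j" "j < n" for j
  proof -
    have "N j \<in> B \<union> W" unfolding NBW[symmetric] using that by (intro imageI) simp
    then show ?thesis using BWk by (auto simp: mker_def)
  qed
  moreover have "det V \<noteq> 0" using c by simp
  ultimately have "poly_basis n ?K ((\<lambda>j. ?v (N j)) ` {m..<n})"
    by (rule kernel_basis_from_completion[OF Pc \<open>m < n\<close> _ V_def _ PV])
  also have "(\<lambda>j. ?v (N j)) ` {m..<n} = ?v ` (B \<union> W)"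
    unfolding NBW[symmetric] image_image ..
  finally have D: "poly_basis n ?K (?v ` (B \<union> W))" .
  have injv: "inj_on ?v (B \<union> W)"
  proof (rule inj_onI)
    fix x y assume xy: "x \<in> B \<union> W" "y \<in> B \<union> W" and eq: "?v x = ?v y"
    have zero: "coeff z j = 0" if "z \<in> B \<union> W" "n \<le> j" for z j
      using that BWk Pc by (intro vpoly_coeff_zero[of z n "Suc (Suc a)"]) (auto simp: mker_def)
    show "x = y"
    proof (rule poly_eqI)
      fix j
      show "coeff x j = coeff y j"
      proof (cases "j < n")
        case True
        then show ?thesis using arg_cong[OF eq, of "\<lambda>v. v $ j"] by simp
      qed (use zero xy in simp)
    qed
  qed
  have deg: "vec_degree (?v x) \<le> k" if "x \<in> mker P (Suc k)" for x k
    using that \<open>m < n\<close> Pc by (subst vec_degree_le_iff[of _ n]) (auto simp: mker_def vpoly_Suc_iff)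
  have "(\<Sum>b\<in>?v ` (B \<union> W). vec_degree b) = (\<Sum>x\<in>B. vec_degree (?v x)) + (\<Sum>x\<in>W. vec_degree (?v x))"
    unfolding sum.reindex[OF injv] using fin BW(1) by (simp add: sum.union_disjoint)
  also have "\<dots> \<le> card B * a + card W * Suc a"
  proof (rule add_mono)
    show "(\<Sum>x\<in>B. vec_degree (?v x)) \<le> card B * a"
      using sum_mono[of B "\<lambda>x. vec_degree (?v x)" "\<lambda>_. a"] BW(3) deg by auto
    show "(\<Sum>x\<in>W. vec_degree (?v x)) \<le> card W * Suc a"
      using sum_mono[of W "\<lambda>x. vec_degree (?v x)" "\<lambda>_. Suc a"] BW(4) deg by auto
  qed
  finally have sumD: "(\<Sum>b\<in>?v ` (B \<union> W). vec_degree b) \<le> card B * a + card W * Suc a" .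
  have cD: "card (?v ` (B \<union> W)) = card B + card W"
    using fin BW(1) by (simp add: card_image[OF injv] card_Un_disjoint)
  have cC: "finite C" "card C = card B + card W" if C: "poly_basis n ?K C" for C
    using C poly_basis_card[OF Pc C D] cD by (simp_all add: poly_basis_def)
  \<comment> \<open>\<open>B\<close> serves as the generating set, so at most \<open>card B\<close>
    members of any polynomial basis have degree at most \<open>a\<close>.\<close>
  note degs = poly_basis_degrees[OF full \<open>m < n\<close> fin(1) BW(5)]
  have basis1: "card B * a + card W * Suc a \<le> (\<Sum>b\<in>C. vec_degree b)"
    if C: "poly_basis n ?K C" for C
    by (rule degree_multiset_unique(1)[OF cC[OF C] degs[OF C]])
  have basis2: "image_mset vec_degree (mset_set C)
      = replicate_mset (card B) a + replicate_mset (card W) (Suc a)"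
    if C: "poly_basis n ?K C" and "(\<Sum>b\<in>C. vec_degree b) \<le> card B * a + card W * Suc a" for C
    by (rule degree_multiset_unique(2)[OF cC[OF C] degs[OF C] that(2)])
  have minD: "minimal_basis n ?K (?v ` (B \<union> W))"
    unfolding minimal_basis_def
  proof (intro conjI allI impI D)
    fix C assume C: "poly_basis n ?K C"
    show "(\<Sum>b\<in>?v ` (B \<union> W). vec_degree b) \<le> (\<Sum>b\<in>C. vec_degree b)"
      using sumD basis1[OF C] by (rule order_trans)
  qed
  have mset: "image_mset vec_degree (mset_set C)
      = replicate_mset (card B) a + replicate_mset (card W) (Suc a)" if "minimal_basis n ?K C" for C
  proof -
    from that have C: "poly_basis n ?K C"
      and le: "(\<Sum>b\<in>C. vec_degree b) \<le> (\<Sum>b\<in>?v ` (B \<union> W). vec_degree b)"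
      using D by (simp_all add: minimal_basis_def)
    show ?thesis by (rule basis2[OF C order_trans[OF le sumD]])
  qed
  have "minimal_indices n ?K = replicate (card W) (Suc a) @ replicate (card B) a"
    unfolding minimal_indices_def
  proof (rule the_equality)
    show "\<exists>C. minimal_basis n ?K C \<and> replicate (card W) (Suc a) @ replicate (card B) a =
        rev (sorted_list_of_multiset (image_mset vec_degree (mset_set C)))"
      using minD by (intro exI conjI, assumption) (simp only: mset[OF minD] sorted_list_of_replicate_mset rev_append rev_replicate)
    fix ds assume "\<exists>C. minimal_basis n ?K C \<and>
        ds = rev (sorted_list_of_multiset (image_mset vec_degree (mset_set C)))"
    then obtain C where C: "minimal_basis n ?K C"
      "ds = rev (sorted_list_of_multiset (image_mset vec_degree (mset_set C)))" by (elim exE conjE)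
    show "ds = replicate (card W) (Suc a) @ replicate (card B) a"
      unfolding C(2) mset[OF C(1)] sorted_list_of_replicate_mset rev_append rev_replicate ..
  qed
  then show "right_minimal_indices P = replicate (n - m - p) (Suc a) @ replicate p a"
    unfolding right_minimal_indices_def carrier_matD[OF Pc] qW unfolding pB .
qed

section \<open>Reversal\<close>

lemma coeff_rev_poly: "coeff (rev_poly d p) i = (if i \<le> d then coeff p (d - i) else 0)"
  by (auto simp: rev_poly_def coeff_sum if_distrib sum.delta cong: if_cong)

lemma degree_rev_poly_le: "degree (rev_poly d p) \<le> d"
  by (rule degree_le) (simp add: coeff_rev_poly)

lemma rev_poly_rev_poly: "degree p \<le> d \<Longrightarrow> rev_poly d (rev_poly d p) = p"
  by (rule poly_eqI) (auto simp: coeff_rev_poly coeff_eq_0)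

lemma rev_poly_0 [simp]: "rev_poly d 0 = 0"
  by (rule poly_eqI) (simp add: coeff_rev_poly)

lemma rev_poly_sum: "rev_poly d (\<Sum>i\<in>A. f i) = (\<Sum>i\<in>A. rev_poly d (f i))"
  by (rule poly_eqI) (simp add: coeff_rev_poly coeff_sum)

text \<open>\<open>reflect_poly\<close> reverses at the true degree; the monomial makes up the
  difference to the grade.\<close>

lemma rev_poly_eq_reflect_poly:
  "degree p \<le> d \<Longrightarrow> rev_poly d p = monom 1 (d - degree p) * reflect_poly p"
  by (rule poly_eqI) (auto simp: coeff_rev_poly coeff_monom_mult coeff_reflect_poly coeff_eq_0)

lemma rev_poly_mult:
  assumes "degree p \<le> d" "degree q \<le> k"
  shows "rev_poly (d + k) (p * q) = rev_poly d p * rev_poly k q"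
proof (cases "p = 0 \<or> q = 0")
  case False
  then have deg: "degree (p * q) = degree p + degree q" by (simp add: degree_mult_eq)
  then have deg_le: "degree (p * q) \<le> d + k" using assms by simp
  have "monom 1 (d + k - degree (p * q)) = monom 1 (d - degree p) * monom (1::complex) (k - degree q)"
    using assms by (simp add: mult_monom deg)
  then show ?thesis
    unfolding rev_poly_eq_reflect_poly[OF assms(1)] rev_poly_eq_reflect_poly[OF assms(2)]
      rev_poly_eq_reflect_poly[OF deg_le] reflect_poly_mult
    by (simp only: ac_simps)
qed auto

definition rev_vec :: "nat \<Rightarrow> nat \<Rightarrow> complex poly poly \<Rightarrow> complex poly poly" where
  "rev_vec n k x = vec_of n (\<lambda>j. rev_poly k (coeff x j))"

lemma rev_vec_in_vpoly: "rev_vec n k x \<in> vpoly n (Suc k)"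
  by (simp add: rev_vec_def vpoly_Suc_iff degree_rev_poly_le)

lemma rev_vec_rev_vec: "x \<in> vpoly n (Suc k) \<Longrightarrow> rev_vec n k (rev_vec n k x) = x"
  by (rule poly_eqI) (auto simp: rev_vec_def rev_poly_rev_poly vpoly_Suc_iff)

lemma rev_vec_0 [simp]: "rev_vec n k 0 = 0"
  by (rule poly_eqI) (simp add: rev_vec_def)

lemma act_rev_mat:
  assumes P: "P \<in> POL d m n" and x: "x \<in> vpoly n (Suc k)"
  shows "act (rev_mat d P) (rev_vec n k x) = rev_vec m (d + k) (act P x)"
proof (rule poly_eqI)
  fix i
  have "rev_poly (d + k) (P $$ (i, j) * coeff x j) = rev_poly d (P $$ (i, j)) * rev_poly k (coeff x j)"
    if "i < m" "j < n" for j
    using x by (intro rev_poly_mult degree_POL[OF P that]) (simp add: vpoly_Suc_iff)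
  then show "coeff (act (rev_mat d P) (rev_vec n k x)) i = coeff (rev_vec m (d + k) (act P x)) i"
    using P by (auto simp: coeff_act rev_vec_def rev_mat_def rev_poly_sum POL_def intro!: sum.cong)
qed

lemma rev_mat_POL: "P \<in> POL d m n \<Longrightarrow> rev_mat d P \<in> POL d m n"
  by (auto simp: POL_def rev_mat_def degree_rev_poly_le)

text \<open>Reversal is an involution on vectors of bounded degree and carries the action of
  \<open>P\<close> to that of \<open>rev_mat d P\<close>, so injectivity and surjectivity transfer.
  This controls the infinite elementary divisors.\<close>

lemma full_rank_at_rev_mat:
  assumes full: "full_rank_at d m n a P"
  shows "full_rank_at d m n a (rev_mat d P)"
proof -
  from full have P: "P \<in> POL d m n" and inj: "\<And>x. x \<in> vpoly n a \<Longrightarrow> act P x = 0 \<Longrightarrow> x = 0"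
    and surj: "vpoly m (Suc a + d) \<subseteq> act P ` vpoly n (Suc a)"
    by (auto simp: full_rank_at_def)
  have "x = 0" if x: "x \<in> vpoly n a" and act: "act (rev_mat d P) x = 0" for x
  \<comment> \<open>Reversal is taken at a degree bound \<open>k\<close> with
    \<open>a = Suc k\<close>; for \<open>a = 0\<close> only the zero vector remains.\<close>
  proof (cases a)
    case 0
    then show ?thesis using x vpoly_0_right by simp
  next
    case (Suc k)
    let ?y = "rev_vec n k x"
    have xk: "x \<in> vpoly n (Suc k)" using x Suc by simp
    have "act P ?y \<in> vpoly m (Suc k + d)" by (rule act_in_vpoly[OF P rev_vec_in_vpoly])
    then have "rev_vec m (d + k) (rev_vec m (d + k) (act P ?y)) = act P ?y"
      by (intro rev_vec_rev_vec) (simp add: add.commute)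
    moreover have "rev_vec m (d + k) (act P ?y) = 0"
      using act_rev_mat[OF P rev_vec_in_vpoly, of k x] act rev_vec_rev_vec[OF xk] by simp
    ultimately have "act P ?y = 0" by simp
    then have "?y = 0" using inj rev_vec_in_vpoly[of n k x] Suc by simp
    then show ?thesis using rev_vec_rev_vec[OF xk] by simp
  qed
  moreover have "vpoly m (Suc a + d) \<subseteq> act (rev_mat d P) ` vpoly n (Suc a)"
  proof
    fix y assume y: "y \<in> vpoly m (Suc a + d)"
    have y': "y \<in> vpoly m (Suc (d + a))" using y by (simp add: add.commute)
    have "rev_vec m (d + a) y \<in> vpoly m (Suc a + d)"
      using rev_vec_in_vpoly[of m "d + a" y] by (simp add: add.commute)
    then obtain x where x: "x \<in> vpoly n (Suc a)" "rev_vec m (d + a) y = act P x"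
      using surj by (meson imageE subsetD)
    have "act (rev_mat d P) (rev_vec n a x) = y"
      using act_rev_mat[OF P x(1)] x(2) rev_vec_rev_vec[OF y'] by simp
    then show "y \<in> act (rev_mat d P) ` vpoly n (Suc a)" using rev_vec_in_vpoly by blast
  qed
  ultimately show ?thesis using rev_mat_POL[OF P] by (simp add: full_rank_at_def)
qed

text \<open>The invariant polynomials of \<open>P\<close> and of its reversal are all 1 and have no
  roots, so there are no elementary divisors.\<close>

lemma complete_eigenstructure_full_rank:
  assumes full: "full_rank_at d m n (m * d div (n - m)) P" and "m < n"
  shows "normal_rank P = m" "complete_eigenstructure d P = K_rp d m n"
proof -
  define a where "a = m * d div (n - m)"
  define s where "s = m * d mod (n - m)"
  have s: "s < n - m" and md: "m * d = a * (n - m) + s"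
    using \<open>m < n\<close> by (simp add: s_def) (simp only: a_def s_def div_mult_mod_eq)
  \<comment> \<open>Writing \<open>md = a (n - m) + s\<close> gives \<open>n - m - s\<close> as the
    dimension of the kernel vectors of degree at most \<open>a\<close>.\<close>
  have p: "n * Suc a = (n - m - s) + m * (Suc a + d)"
  proof -
    have "n = m + (n - m)" using \<open>m < n\<close> by simp
    then have "n * Suc a = m * Suc a + (n - m) * Suc a" by (metis add_mult_distrib)
    also have "\<dots> = m * Suc a + (n - m - s) + (a * (n - m) + s)" using s by simp
    also have "\<dots> = (n - m - s) + m * (Suc a + d)" unfolding md[symmetric] by (simp add: algebra_simps)
    finally show ?thesis .
  qed
  have full': "full_rank_at d m n a P" using full by (simp add: a_def)
  note S = full_rank_at_structure[OF full' \<open>m < n\<close> p]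
  note R = full_rank_at_structure[OF full_rank_at_rev_mat[OF full'] \<open>m < n\<close> p]
  show "normal_rank P = m" by (rule S(1))
  have "n - m - (n - m - s) = s" using s by simp
  moreover have "finite_eigenvalues P = {}" "finite_eigenvalues (rev_mat d P) = {}"
    "eldivs_at c P = {#}" "eldivs_at c (rev_mat d P) = {#}" for c
    by (simp_all add: finite_eigenvalues_def eldivs_at_def S R)
  ultimately show "complete_eigenstructure d P = K_rp d m n"
    using S(3,5) by (simp add: complete_eigenstructure_def K_rp_def Let_def a_def s_def)
qed

section \<open>Genericity\<close>

lemma act_add_smult:
  assumes "P \<in> carrier_mat m n" "K \<in> carrier_mat m n"
  shows "act (P + [:t:] \<cdot>\<^sub>m K) x = act P x + cscale t (act K x)"
proof (rule poly_eqI)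
  fix i
  show "coeff (act (P + [:t:] \<cdot>\<^sub>m K) x) i = coeff (act P x + cscale t (act K x)) i"
  proof (cases "i < m")
    case True
    have "(\<Sum>j<n. (P + [:t:] \<cdot>\<^sub>m K) $$ (i, j) * coeff x j) =
        (\<Sum>j<n. P $$ (i, j) * coeff x j + [:t:] * (K $$ (i, j) * coeff x j))"
      by (rule sum.cong) (use assms True in \<open>simp_all add: distrib_right\<close>)
    also have "\<dots> = (\<Sum>j<n. P $$ (i, j) * coeff x j) + [:t:] * (\<Sum>j<n. K $$ (i, j) * coeff x j)"
      by (simp only: sum.distrib sum_distrib_left)
    finally show ?thesis using assms True by (simp add: coeff_act)
  qed (use assms in \<open>simp add: coeff_act\<close>)
qed

text \<open>Both conditions hold for \<open>K\<close>, so each fails along the line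
  \<open>P + t K\<close> for finitely many \<open>t\<close> only.\<close>

lemma finite_not_full_rank_parameters:
  assumes K: "full_rank_at d m n a K" and P: "P \<in> POL d m n"
  shows "finite {t. \<not> full_rank_at d m n a (P + [:t:] \<cdot>\<^sub>m K)}"
proof -
  from K have KP: "K \<in> POL d m n" by (simp add: full_rank_at_def)
  have carr: "P \<in> carrier_mat m n" "K \<in> carrier_mat m n" using P KP by (auto simp: POL_def)
  have POL: "P + [:t:] \<cdot>\<^sub>m K \<in> POL d m n" for t
    using P KP by (auto simp: POL_def intro!: degree_add_le order_trans[OF degree_smult_le])
  let ?A = "{t. \<exists>x\<in>vpoly n a. x \<noteq> 0 \<and> act P x + cscale t (act K x) = 0}"
  let ?B = "{t. \<not> vpoly m (Suc a + d) \<subseteq> (\<lambda>x. act P x + cscale t (act K x)) ` vpoly n (Suc a)}"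
  have "finite ?A"
    using K by (intro cvec.finite_singular_parameters_inj[OF linear_act linear_act subspace_vpoly
        finite_vbasis vpoly_subset_span]) (auto simp: full_rank_at_def)
  moreover have "finite ?B"
  proof (rule cvec.finite_singular_parameters_surj[OF linear_act linear_act subspace_vpoly
        subspace_vpoly finite_vbasis vpoly_subset_span])
    show "act K ` vpoly n (Suc a) = vpoly m (Suc a + d)"
    proof (rule equalityI)
      show "act K ` vpoly n (Suc a) \<subseteq> vpoly m (Suc a + d)"
        by (rule image_subsetI) (rule act_in_vpoly[OF KP])
    qed (use K in \<open>simp add: full_rank_at_def\<close>)
    show "act P ` vpoly n (Suc a) \<subseteq> vpoly m (Suc a + d)"
      by (rule image_subsetI) (rule act_in_vpoly[OF P])
  qed
  ultimately have "finite (?A \<union> ?B)" by simp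
  moreover have "{t. \<not> full_rank_at d m n a (P + [:t:] \<cdot>\<^sub>m K)} \<subseteq> ?A \<union> ?B"
    using POL by (auto simp: full_rank_at_def act_add_smult[OF carr])
  ultimately show ?thesis by (rule finite_subset[rotated])
qed

lemma pol_dist_add_smult:
  assumes "P \<in> carrier_mat m n" "K \<in> carrier_mat m n"
  shows "pol_dist d m n P (P + [:t:] \<cdot>\<^sub>m K) = cmod t * pol_dist d m n (0\<^sub>m m n) K"
proof -
  have "pol_dist d m n P (P + [:t:] \<cdot>\<^sub>m K) =
      L2_set (\<lambda>x. cmod t * (case x of (k, i, j) \<Rightarrow> cmod (coeff (0\<^sub>m m n $$ (i, j)) k - coeff (K $$ (i, j)) k)))
        ({..d} \<times> {..<m} \<times> {..<n})"
    unfolding pol_dist_L2_set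
    by (rule L2_set_cong) (use assms in \<open>auto simp: norm_mult\<close>)
  also have "\<dots> = cmod t * pol_dist d m n (0\<^sub>m m n) K"
    unfolding pol_dist_L2_set by (rule L2_set_right_distrib[symmetric]) simp
  finally show ?thesis .
qed

text \<open>Every ball around \<open>P\<close> contains \<open>P + t K\<close> for all small
  \<open>t\<close>, of which only finitely many are exceptional. \<open>S\<close> may be larger than
  the full-rank set, since an orbit is only known to contain it.\<close>

lemma closure_full_rank:
  assumes K: "full_rank_at d m n a K" and S: "{Q. full_rank_at d m n a Q} \<subseteq> S" "S \<subseteq> POL d m n"
  shows "POL_topology d m n closure_of S = POL d m n"
proof -
  interpret Metric_space "POL d m n" "pol_dist d m n" by (rule Metric_space_POL)
  have KP: "K \<in> POL d m n" using K by (simp add: full_rank_at_def)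
  have "\<exists>Q\<in>S. Q \<in> mball P r" if P: "P \<in> POL d m n" and "0 < r" for P r
  proof -
    let ?c = "pol_dist d m n (0\<^sub>m m n) K"
    let ?T = "{t. \<not> full_rank_at d m n a (P + [:t:] \<cdot>\<^sub>m K)}"
    \<comment> \<open>The summand 1 makes the divisor positive without a case split.\<close>
    have c: "0 < ?c + 1" using nonneg[of "0\<^sub>m m n" K] by linarith
    have "0 < r / (?c + 1)" using \<open>0 < r\<close> c by (rule divide_pos_pos)
    then have "infinite (ball (0::complex) (r / (?c + 1)))"
      using finite_imp_not_open[of "ball (0::complex) (r / (?c + 1))"]
      by (metis centre_in_ball empty_iff open_ball)
    then have "infinite (ball (0::complex) (r / (?c + 1)) - ?T)"
      using finite_not_full_rank_parameters[OF K P] by (rule Diff_infinite_finite[rotated])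
    then have "ball (0::complex) (r / (?c + 1)) - ?T \<noteq> {}" by (rule infinite_imp_nonempty)
    then obtain t where "t \<in> ball 0 (r / (?c + 1)) - ?T" by (rule ex_in_conv[THEN iffD2, THEN exE])
    note t = DiffD1[OF this] DiffD2[OF this]
    let ?Q = "P + [:t:] \<cdot>\<^sub>m K"
    have "cmod t * (?c + 1) < r" using t(1) c by (simp add: pos_less_divide_eq)
    moreover have "cmod t * ?c \<le> cmod t * (?c + 1)" by (simp add: mult_left_mono)
    ultimately have "pol_dist d m n P ?Q < r"
      using pol_dist_add_smult[of P m n K d t] P KP by (simp add: POL_def)
    moreover have "full_rank_at d m n a ?Q"
    proof (rule ccontr)
      assume "\<not> full_rank_at d m n a ?Q"
      then have "t \<in> ?T" by simp
      then show False by (rule t(2))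
    qed
    moreover from this have "?Q \<in> POL d m n" by (simp add: full_rank_at_def)
    ultimately show ?thesis using S(1) P by (intro bexI[of _ ?Q]) (auto simp: in_mball)
  qed
  then show ?thesis unfolding POL_topology_def metric_closure_of by auto
qed

section \<open>A matrix polynomial of full rank\<close>

text \<open>These are the endpoints of the \<open>n - m\<close> equal parts of
  \<open>[0, md]\<close>, rounded down to integers.\<close>

definition breakpt :: "nat \<Rightarrow> nat \<Rightarrow> nat \<Rightarrow> nat \<Rightarrow> nat" where
  "breakpt d m n k = k * (m * d) div (n - m)"

text \<open>Column \<open>j \<le> m\<close> belongs to the breakpoint \<open>j d\<close>, which is
  shared by the rows \<open>j - 1\<close> and \<open>j\<close> where these exist. Column
  \<open>m + k\<close> with \<open>0 < k < n - m\<close> belongs to the \<open>k\<close>-th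
  breakpoint of the other subdivision: quotient and remainder on division by \<open>d\<close> are
  the row and the exponent of its only nonzero entry.\<close>

definition zigzag :: "nat \<Rightarrow> nat \<Rightarrow> nat \<Rightarrow> complex poly mat" where
  "zigzag d m n = mat m n (\<lambda>(i, j).
     if j \<le> m then (if j = i then 1 else if j = Suc i then monom 1 d else 0)
     else if i = breakpt d m n (j - m) div d then monom 1 (breakpt d m n (j - m) mod d) else 0)"

lemma breakpt_0 [simp]: "breakpt d m n 0 = 0"
  by (simp add: breakpt_def)

lemma breakpt_last: "m < n \<Longrightarrow> breakpt d m n (n - m) = m * d"
  by (simp add: breakpt_def)

text \<open>The floor of a sum exceeds the sum of the floors by 0 or 1.\<close>

lemma breakpt_Suc:
  assumes "m < n"
  shows "breakpt d m n k + m * d div (n - m) \<le> breakpt d m n (Suc k)"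
    and "breakpt d m n (Suc k) \<le> breakpt d m n k + Suc (m * d div (n - m))"
proof -
  let ?N = "n - m"
  have "(k * (m * d) + m * d) div ?N = k * (m * d) div ?N + m * d div ?N +
      (k * (m * d) mod ?N + m * d mod ?N) div ?N"
    by (rule div_add1_eq)
  moreover have "(k * (m * d) mod ?N + m * d mod ?N) div ?N < 2"
    using assms mod_less_divisor[of ?N "k * (m * d)"] mod_less_divisor[of ?N "m * d"]
    by (intro less_mult_imp_div_less) linarith
  ultimately show "breakpt d m n k + m * d div ?N \<le> breakpt d m n (Suc k)"
    "breakpt d m n (Suc k) \<le> breakpt d m n k + Suc (m * d div ?N)"
    by (auto simp: breakpt_def add.commute)
qed

lemma breakpt_mono: "k \<le> l \<Longrightarrow> breakpt d m n k \<le> breakpt d m n l"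
  by (simp add: breakpt_def div_le_mono)

lemma breakpt_less: "m < n \<Longrightarrow> 0 < m \<Longrightarrow> 0 < d \<Longrightarrow> k < n - m \<Longrightarrow> breakpt d m n k < m * d"
  by (simp add: breakpt_def less_mult_imp_div_less)

text \<open>Hence the half-open intervals of length \<alpha> starting at the breakpoints are
  disjoint, which is what injectivity of the zigzag matrix rests on.\<close>

lemma breakpt_gap:
  assumes "m < n" "k < l"
  shows "breakpt d m n k + m * d div (n - m) \<le> breakpt d m n l"
  using breakpt_Suc(1)[OF assms(1), of d k] breakpt_mono[of "Suc k" l d m n] assms(2) by linarith

text \<open>Take the last breakpoint not above \<open>g\<close>. The next one is above
  \<open>g\<close> but at most \<open>\<alpha> + 1\<close> further on; after the final breakpoint
  the bound on \<open>g\<close> takes over. Surjectivity rests on this covering by closed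
  intervals.\<close>

lemma breakpt_cover:
  assumes "m < n" "g \<le> m * d + m * d div (n - m)"
  obtains k where "k \<le> n - m" "breakpt d m n k \<le> g" "g \<le> breakpt d m n k + m * d div (n - m)"
proof -
  let ?S = "{k. k \<le> n - m \<and> breakpt d m n k \<le> g}"
  have fin: "finite ?S" by simp
  have "0 \<in> ?S" by simp
  define M where "M = Max ?S"
  have M: "M \<in> ?S" unfolding M_def using fin \<open>0 \<in> ?S\<close> by (intro Max_in) auto
  show ?thesis
  proof (rule that[of M])
    show "M \<le> n - m" "breakpt d m n M \<le> g" using M by simp_all
    show "g \<le> breakpt d m n M + m * d div (n - m)"
    proof (cases "M = n - m")
      case True
      then show ?thesis using assms by (simp add: breakpt_last)
    next
      case False
      have "Suc M \<notin> ?S"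
      proof
        assume "Suc M \<in> ?S"
        then have "Suc M \<le> M" unfolding M_def by (rule Max_ge[OF fin])
        then show False by simp
      qed
      then have "g < breakpt d m n (Suc M)" using False M by auto
      then show ?thesis using breakpt_Suc(2)[OF assms(1), of d M] by linarith
    qed
  qed
qed

lemma zigzag_POL: "0 < d \<Longrightarrow> zigzag d m n \<in> POL d m n"
  by (auto simp: POL_def zigzag_def degree_monom_eq less_imp_le)

lemma mat_degree_zigzag:
  assumes "0 < m" "0 < d" "m < n"
  shows "mat_degree (zigzag d m n) = d"
  unfolding mat_degree_def
proof (rule Max_eqI)
  show "finite (degree ` elements_mat (zigzag d m n))" by (simp add: elements_mat_def)
  show "y \<le> d" if "y \<in> degree ` elements_mat (zigzag d m n)" for y
    using that zigzag_POL[OF \<open>0 < d\<close>, of m n] by (auto simp: POL_def dest!: elements_matD)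
  have "zigzag d m n $$ (0, 1) = monom 1 d" using assms by (simp add: zigzag_def)
  moreover have "zigzag d m n $$ (0, 1) \<in> elements_mat (zigzag d m n)"
    using assms by (intro elements_matI[of _ m n 0 1]) (simp_all add: zigzag_def)
  ultimately show "d \<in> degree ` elements_mat (zigzag d m n)"
    by (metis degree_monom_eq image_eqI zero_neq_one)
qed

text \<open>After row \<open>i\<close> is multiplied by \<open>\<lambda>\<^bsup>id\<^esup>\<close>, each unknown occurs with the power of \<open>\<lambda>\<close> given by its breakpoint,
  independently of the row. Hence the equations for different powers of \<open>\<lambda>\<close> decouple.\<close>

lemma zigzag_row:
  assumes "m < n" "i < m"
  shows "monom 1 (i * d) * coeff (act (zigzag d m n) x) i =
    monom 1 (i * d) * coeff x i + monom 1 (Suc i * d) * coeff x (Suc i) +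
    (\<Sum>k = 1..<n - m. if breakpt d m n k div d = i
       then monom 1 (breakpt d m n k) * coeff x (m + k) else 0)"
proof -
  let ?Z = "zigzag d m n"
  let ?b = "breakpt d m n"
  have "coeff (act ?Z x) i = (\<Sum>j<n. ?Z $$ (i, j) * coeff x j)"
    using assms by (simp add: coeff_act zigzag_def)
  also have "{..<n} = {..m} \<union> {m + 1..<m + (n - m)}" using assms(1) by auto
  also have "(\<Sum>j\<in>{..m} \<union> {m + 1..<m + (n - m)}. ?Z $$ (i, j) * coeff x j) =
      (\<Sum>j\<le>m. ?Z $$ (i, j) * coeff x j) + (\<Sum>j = m + 1..<m + (n - m). ?Z $$ (i, j) * coeff x j)"
    by (rule sum.union_disjoint) auto
  also have "(\<Sum>j\<le>m. ?Z $$ (i, j) * coeff x j) =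
      (\<Sum>j\<le>m. (if j = i then coeff x j else 0) + (if j = Suc i then monom 1 d * coeff x j else 0))"
    using assms by (intro sum.cong) (auto simp: zigzag_def)
  also have "\<dots> = coeff x i + monom 1 d * coeff x (Suc i)"
    using assms by (simp add: sum.distrib)
  also have "(\<Sum>j = m + 1..<m + (n - m). ?Z $$ (i, j) * coeff x j) =
      (\<Sum>k = 1..<n - m. ?Z $$ (i, m + k) * coeff x (m + k))"
    using sum.shift_bounds_nat_ivl[of "\<lambda>j. ?Z $$ (i, j) * coeff x j" 1 m "n - m"]
    by (simp add: add.commute)
  also have "\<dots> = (\<Sum>k = 1..<n - m. if ?b k div d = i then monom 1 (?b k mod d) * coeff x (m + k) else 0)"
    using assms by (intro sum.cong) (auto simp: zigzag_def)
  finally have "monom 1 (i * d) * coeff (act ?Z x) i = monom 1 (i * d) * coeff x i +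
      monom 1 (i * d) * (monom 1 d * coeff x (Suc i)) + (\<Sum>k = 1..<n - m. monom 1 (i * d) *
        (if ?b k div d = i then monom 1 (?b k mod d) * coeff x (m + k) else 0))"
    by (simp only: distrib_left sum_distrib_left)
  also have "(\<Sum>k = 1..<n - m. monom 1 (i * d) *
        (if ?b k div d = i then monom 1 (?b k mod d) * coeff x (m + k) else 0)) =
      (\<Sum>k = 1..<n - m. if ?b k div d = i then monom 1 (?b k) * coeff x (m + k) else 0)"
    by (rule sum.cong) (auto simp: mult_monom simp flip: mult.assoc)
  also have "monom 1 (i * d) * (monom 1 d * coeff x (Suc i)) = monom 1 (Suc i * d) * coeff x (Suc i)"
    by (simp add: mult_monom add.commute flip: mult.assoc)
  finally show ?thesis .
qed

lemma alternating_telescope: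
  fixes f :: "nat \<Rightarrow> 'a :: comm_ring_1"
  shows "(\<Sum>i<m. (- 1) ^ i * (f i + f (Suc i))) = f 0 - (- 1) ^ m * f m"
  by (induction m) (simp_all add: algebra_simps)

text \<open>For each power \<open>g\<close> of \<lambda> the unknowns satisfy a separate system. An
  unknown with breakpoint \<open>b\<close> can contribute only if
  \<open>b <= g < b + \<alpha>\<close>, and these intervals are disjoint for the breakpoints of the
  subdivision into \<open>n - m\<close> parts.\<close>

lemma zigzag_injective:
  assumes "0 < m" "0 < d" "m < n" and x: "x \<in> vpoly n (m * d div (n - m))"
    and act: "act (zigzag d m n) x = 0"
  shows "x = 0"
proof -
  let ?a = "m * d div (n - m)" and ?b = "breakpt d m n"
  define y where "y = (\<lambda>i g. coeff (monom 1 (i * d) * coeff x i) g)"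
  define z where "z = (\<lambda>k g. coeff (monom 1 (?b k) * coeff x (m + k)) g)"
  have row: "y i g + y (Suc i) g + (\<Sum>k = 1..<n - m. if ?b k div d = i then z k g else 0) = 0"
    if "i < m" for i g
  proof -
    have "(\<Sum>k = 1..<n - m. if ?b k div d = i then z k g else 0) =
      coeff (\<Sum>k = 1..<n - m. if ?b k div d = i then monom 1 (?b k) * coeff x (m + k) else 0) g"
      unfolding coeff_sum by (rule sum.cong) (auto simp: z_def)
    then show ?thesis
      using arg_cong[OF zigzag_row[OF \<open>m < n\<close> that, of d x], of "\<lambda>p. coeff p g"]
      by (simp add: act y_def)
  qed
  have supp: "coeff (monom 1 p * coeff x j) g = 0" if "\<not> (p \<le> g \<and> g < p + ?a)" for p j g
  proof (cases "p \<le> g")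
    case True
    then have "?a \<le> g - p" using that by linarith
    then show ?thesis by (simp add: coeff_monom_mult vpoly_coeff[OF x])
  qed (simp add: coeff_monom_mult)
  have zero: "y i g = 0 \<and> (k \<in> {1..<n - m} \<longrightarrow> z k g = 0)" if "i \<le> m" for i k g
  proof -
    \<comment> \<open>There is one term per breakpoint of the subdivision into \<open>n - m\<close>
      parts. The ends 0 and \<open>md\<close> are the breakpoints of the columns \<open>0\<close>
      and \<open>m\<close>, whose signs come from the telescoped sum.\<close>
    define v where "v = (\<lambda>k. if k = 0 then y 0 g else if k = n - m then - ((- 1) ^ m * y m g)
      else (- 1) ^ (?b k div d) * z k g)"
    \<comment> \<open>In the alternating sum of the rows only the unknowns at the breakpoints survive, and the
      degree bound lets at most one of them be nonzero.\<close>
    have "0 = (\<Sum>i<m. (- 1) ^ i * (y i g + y (Suc i) g +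
        (\<Sum>k = 1..<n - m. if ?b k div d = i then z k g else 0)))"
      by (rule sum.neutral[symmetric], rule ballI, simp only: row lessThan_iff mult_zero_right)
    also have "\<dots> = (\<Sum>i<m. (- 1) ^ i * (y i g + y (Suc i) g)) +
        (\<Sum>i<m. \<Sum>k = 1..<n - m. if ?b k div d = i then (- 1) ^ i * z k g else 0)"
      by (simp add: distrib_left sum.distrib sum_distrib_left if_distrib cong: if_cong)
    also have "(\<Sum>i<m. (- 1) ^ i * (y i g + y (Suc i) g)) = y 0 g - (- 1) ^ m * y m g"
      by (rule alternating_telescope)
    also have "(\<Sum>i<m. \<Sum>k = 1..<n - m. if ?b k div d = i then (- 1) ^ i * z k g else 0) =
        (\<Sum>k = 1..<n - m. \<Sum>i<m. if ?b k div d = i then (- 1) ^ i * z k g else 0)"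
      by (rule sum.swap)
    also have "\<dots> = (\<Sum>k = 1..<n - m. v k)"
    proof (rule sum.cong[OF refl])
      fix k assume k: "k \<in> {1..<n - m}"
      then have "?b k div d < m"
        using breakpt_less[OF \<open>m < n\<close> \<open>0 < m\<close> \<open>0 < d\<close>, of k] by (simp add: less_mult_imp_div_less)
      then show "(\<Sum>i<m. if ?b k div d = i then (- 1) ^ i * z k g else 0) = v k"
        using k by (simp add: v_def)
    qed
    also have "y 0 g - (- 1) ^ m * y m g + (\<Sum>k = 1..<n - m. v k) = (\<Sum>k\<le>n - m. v k)"
    proof -
      have "{..n - m} = insert 0 (insert (n - m) {1..<n - m})" using \<open>m < n\<close> by auto
      then show ?thesis using \<open>m < n\<close> by (simp add: v_def)
    qed
    finally have sum: "(\<Sum>k\<le>n - m. v k) = 0" ..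
    \<comment> \<open>The columns \<open>0\<close>, \<open>m\<close> and \<open>m + k\<close> are
      those of the breakpoint in the three cases.\<close>
    have active: "?b k \<le> g \<and> g < ?b k + ?a" if "k \<le> n - m" "v k \<noteq> 0" for k
      using that supp[of "?b k" g "if k = 0 then 0 else if k = n - m then m else m + k"] \<open>m < n\<close>
      by (auto simp: v_def y_def z_def breakpt_last split: if_splits)
    have unique: "k = l" if "k \<le> n - m" "l \<le> n - m" "v k \<noteq> 0" "v l \<noteq> 0" for k l
      using active[OF that(1,3)] active[OF that(2,4)] breakpt_gap[OF \<open>m < n\<close>, of k l d]
        breakpt_gap[OF \<open>m < n\<close>, of l k d] by linarith
    have v0: "v k = 0" if k: "k \<le> n - m" for k
    proof (rule ccontr)
      assume "v k \<noteq> 0"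
      then have "(\<Sum>l\<le>n - m. v l) = (\<Sum>l\<in>{k}. v l)"
      proof (intro sum.mono_neutral_right ballI)
        fix l assume l: "l \<in> {..n - m} - {k}"
        show "v l = 0"
        proof (rule ccontr)
          assume "v l \<noteq> 0"
          then have "k = l" using l by (intro unique[OF k _ \<open>v k \<noteq> 0\<close>]) simp_all
          then show False using l by simp
        qed
      qed (use k in simp_all)
      then show False using sum \<open>v k \<noteq> 0\<close> by simp
    qed
    have z0: "z k g = 0" if "k \<in> {1..<n - m}" for k
      using v0[of k] that by (simp add: v_def)
    \<comment> \<open>Once \<open>y 0\<close> and all \<open>z k\<close> vanish, row
      \<open>i\<close> reads \<open>y i + y (i + 1) = 0\<close>, so zeros propagate.\<close>
    have "y i g = 0"
      using \<open>i \<le> m\<close>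
    proof (induction i)
      case 0
      then show ?case using v0[of 0] by (simp add: v_def)
    next
      case (Suc i)
      have "(\<Sum>k = 1..<n - m. if ?b k div d = i then z k g else 0) = 0"
        using z0 by (intro sum.neutral) auto
      then show ?case using Suc row[of i g] by simp
    qed
    then show ?thesis using z0 by simp
  qed
  have nz: "coeff x j = 0" if "monom 1 p * coeff x j = 0" for p j using that by simp
  show "x = 0"
  proof (rule poly_eqI)
    fix j
    consider "j \<le> m" | "j - m \<in> {1..<n - m}" "m < j" | "n \<le> j" by force
    then have "coeff x j = 0"
    proof cases
      case 1
      then have "monom 1 (j * d) * coeff x j = 0" using zero[of j] by (intro poly_eqI) (simp add: y_def)
      then show ?thesis by (rule nz)
    next
      case 2
      then have "monom 1 (?b (j - m)) * coeff x j = 0"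
        using zero[of 0 _ "j - m"] by (intro poly_eqI) (simp add: z_def)
      then show ?thesis by (rule nz)
    next
      case 3
      then show ?thesis by (rule vpoly_coeff_zero[OF x])
    qed
    then show "coeff x j = coeff 0 j" by simp
  qed
qed

section \<open>Surjectivity of the zigzag matrix\<close>

lemma act_vmon:
  assumes "P \<in> carrier_mat m n" "j < n"
  shows "act P (vmon j e) = vec_of m (\<lambda>i. P $$ (i, j) * monom 1 e)"
  using assms
  by (intro poly_eqI) (simp add: coeff_act vmon_def if_distrib[of "\<lambda>x. _ * x"] cong: if_cong)

text \<open>The image is a subspace, so it suffices to reach each \<open>vmon i f\<close>. These are
  grouped by \<open>g = i * d + f\<close>, the power of \<lambda> after row \<open>i\<close> is
  multiplied by \<open>\<lambda>^(i d)\<close>; within a group, consecutive rows are linked by a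
  shared column.\<close>

lemma zigzag_surjective:
  assumes "0 < m" "0 < d" "m < n"
  defines "a \<equiv> m * d div (n - m)"
  shows "vpoly m (Suc a + d) \<subseteq> act (zigzag d m n) ` vpoly n (Suc a)" (is "_ \<subseteq> ?I")
proof -
  interpret act: Vector_Spaces.linear cscale cscale "act (zigzag d m n)" by (rule linear_act)
  let ?b = "breakpt d m n"
  have Z: "zigzag d m n \<in> carrier_mat m n" by (simp add: zigzag_def)
  have subI: "cvec.subspace ?I" by (rule act.subspace_image[OF subspace_vpoly])
  have imI: "act (zigzag d m n) (vmon j e) \<in> ?I" if "j < n" "e \<le> a" for j e
    using that by (intro imageI vmon_in_vpoly) auto
  have first: "vmon 0 e \<in> ?I" if "e \<le> a" for e
  proof -
    have "act (zigzag d m n) (vmon 0 e) = vmon 0 e"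
      unfolding act_vmon[OF Z order.strict_trans[OF \<open>0 < m\<close> \<open>m < n\<close>]]
      using assms by (intro poly_eqI) (auto simp: zigzag_def vmon_def)
    then show ?thesis using imI[of 0 e] that assms by simp
  qed
  have last: "vmon (m - 1) (d + e) \<in> ?I" if "e \<le> a" for e
  proof -
    have "act (zigzag d m n) (vmon m e) = vmon (m - 1) (d + e)"
      unfolding act_vmon[OF Z \<open>m < n\<close>]
      using assms by (intro poly_eqI) (auto simp: zigzag_def vmon_def mult_monom)
    then show ?thesis using imI[of m e] that assms by simp
  qed
  have inner: "vmon (?b k div d) (?b k mod d + e) \<in> ?I" if "e \<le> a" "0 < k" "k < n - m" for k e
  proof -
    have mk: "m + k < n" using that by simp
    have "?b k div d < m"
      using breakpt_less[OF \<open>m < n\<close> \<open>0 < m\<close> \<open>0 < d\<close> that(3)] by (simp add: less_mult_imp_div_less)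
    then have "act (zigzag d m n) (vmon (m + k) e) = vmon (?b k div d) (?b k mod d + e)"
      unfolding act_vmon[OF Z mk]
      using mk that by (intro poly_eqI) (auto simp: zigzag_def vmon_def mult_monom)
    then show ?thesis using imI[of "m + k" e] that mk by simp
  qed
  have link: "vmon (Suc i) e + vmon i (d + e) \<in> ?I" if "e \<le> a" "Suc i < m" for i e
  proof -
    have "Suc i < n" using that \<open>m < n\<close> by simp
    then have "act (zigzag d m n) (vmon (Suc i) e) = vmon (Suc i) e + vmon i (d + e)"
      unfolding act_vmon[OF Z \<open>Suc i < n\<close>]
      using that by (intro poly_eqI) (auto simp: zigzag_def vmon_def mult_monom)
    then show ?thesis using imI[of "Suc i" e] that \<open>Suc i < n\<close> by simp
  qed
  \<comment> \<open>For each power \<open>g\<close> a breakpoint puts one row into the image, and the columns shared by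
    consecutive rows propagate this to all others.\<close>
  have mem: "vmon i (g - i * d) \<in> ?I" if i: "i < m" "i * d \<le> g" "g \<le> Suc i * d + a" for i g
  proof -
    have "Suc i * d \<le> m * d" using i(1) by (intro mult_le_mono1) simp
    then have "g \<le> m * d + a" using i(3) by linarith
    then obtain k where k: "k \<le> n - m" "?b k \<le> g" "g \<le> ?b k + a"
      using breakpt_cover[OF \<open>m < n\<close>, of g d] unfolding a_def by auto
    \<comment> \<open>Row \<open>r\<close> is one whose interval from \<open>r d\<close> to
      \<open>(r + 1) d\<close> contains the breakpoint. The end breakpoints use the columns
      \<open>0\<close> and \<open>m\<close>, the others their own column.\<close>
    have "\<exists>r<m. r * d \<le> ?b k \<and> ?b k \<le> Suc r * d \<and> vmon r (g - r * d) \<in> ?I"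
    proof -
      consider "k = 0" | "k = n - m" | "0 < k" "k < n - m" using k(1) by linarith
      then show ?thesis
      proof cases
        case 1
        then show ?thesis using first[of g] k \<open>0 < m\<close> by (intro exI[of _ 0]) simp
      next
        case 2
        then have bk: "?b k = m * d" using \<open>m < n\<close> by (simp add: breakpt_last)
        obtain m' where m': "m = Suc m'" using \<open>0 < m\<close> by (cases m) auto
        have "m * d \<le> g" using k(2) bk by simp
        then have "g - m' * d = d + (g - m * d)" by (simp add: m')
        moreover have "g - m * d \<le> a" using k(3) unfolding bk by linarith
        ultimately have "vmon m' (g - m' * d) \<in> ?I" using last[of "g - m * d"] by (simp add: m')
        then show ?thesis using bk by (intro exI[of _ m']) (simp add: m')
      next
        case 3
        let ?r = "?b k div d"
        have "?r < m"
          using breakpt_less[OF \<open>m < n\<close> \<open>0 < m\<close> \<open>0 < d\<close> 3(2)] by (simp add: less_mult_imp_div_less)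
        moreover have eq: "?b k = ?r * d + ?b k mod d" by simp
        moreover have "?b k mod d < d" using \<open>0 < d\<close> by simp
        moreover have "g - ?r * d = ?b k mod d + (g - ?b k)"
        proof -
          have "?r * d + ?b k mod d \<le> g" using k(2) eq by linarith
          then show ?thesis using eq by linarith
        qed
        moreover have "g - ?b k \<le> a" using k(3) by linarith
        ultimately have "vmon ?r (g - ?r * d) \<in> ?I" using inner[of "g - ?b k" k] 3 by simp
        moreover have "?r * d \<le> ?b k" "?b k \<le> Suc ?r * d"
          using eq \<open>?b k mod d < d\<close> unfolding mult_Suc by linarith+
        ultimately show ?thesis using \<open>?r < m\<close> by blast
      qed
    qed
    then obtain r where r: "r < m" "r * d \<le> ?b k" "?b k \<le> Suc r * d" "vmon r (g - r * d) \<in> ?I"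
      by blast
    have diff: "x \<in> ?I" if "x + y \<in> ?I" "y \<in> ?I" for x y
      using cvec.subspace_diff[OF subI that] by simp
    show ?thesis
    proof (cases "r \<le> i")
      \<comment> \<open>Upwards from \<open>r\<close>: the breakpoint is at most
        \<open>(j + 1) d\<close>, so \<open>g - (j + 1) d\<close> is at most \<open>a\<close> and
        column \<open>j + 1\<close> is available at that degree.\<close>
      case True
      then show ?thesis using i(1,2)
      proof (induction i rule: dec_induct)
        case base
        then show ?case using r(4) by simp
      next
        case (step j)
        have jd: "Suc j * d = d + j * d" by simp
        have "Suc r * d \<le> Suc j * d" using step.hyps(1) by (intro mult_le_mono1) simp
        then have le: "g - Suc j * d \<le> a" using r(3) k(3) by linarith
        have eq: "d + (g - Suc j * d) = g - j * d" using step.prems(2) jd by linarith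
        have "vmon j (g - j * d) \<in> ?I" using step.IH step.prems jd by linarith
        moreover have "vmon (Suc j) (g - Suc j * d) + vmon j (g - j * d) \<in> ?I"
          using link[OF le, of j] step.prems(1) unfolding eq by simp
        ultimately show ?case by (rule diff[rotated])
      qed
    next
      \<comment> \<open>Downwards from \<open>r\<close>: the breakpoint is at least
        \<open>(j + 1) d\<close>, so the natural-number difference \<open>g - (j + 1) d\<close> is
        exact, and its bound by \<open>a\<close> comes from the assumption on
        \<open>g\<close>.\<close>
      case False
      then have "i \<le> r" by simp
      then show ?thesis using i(3)
      proof (induction i rule: inc_induct)
        case base
        then show ?case using r(4) by simp
      next
        case (step j)
        have jd: "Suc j * d = d + j * d" by simp
        have "Suc j * d \<le> r * d" using step.hyps(2) by (intro mult_le_mono1) simp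
        then have le: "Suc j * d \<le> g" using r(2) k(2) by linarith
        have eq: "d + (g - Suc j * d) = g - j * d" using le jd by linarith
        have "g \<le> Suc (Suc j) * d + a" using step.prems unfolding mult_Suc by linarith
        then have IH: "vmon (Suc j) (g - Suc j * d) \<in> ?I" by (rule step.IH)
        have "g - Suc j * d \<le> a" using step.prems by linarith
        then have "vmon (Suc j) (g - Suc j * d) + vmon j (g - j * d) \<in> ?I"
          using link[of "g - Suc j * d" j] step.hyps(2) r(1) unfolding eq by simp
        then have "vmon j (g - j * d) + vmon (Suc j) (g - Suc j * d) \<in> ?I" by (simp add: add.commute)
        then show ?case using IH by (rule diff)
      qed
    qed
  qed
  have "vbasis m (Suc a + d) \<subseteq> ?I"
  proof
    fix y assume "y \<in> vbasis m (Suc a + d)"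
    then obtain i f where je: "i < m" "f < Suc a + d" "y = vmon i f" by (auto simp: vbasis_def)
    have "vmon i (i * d + f - i * d) \<in> ?I" using je(1,2) by (intro mem) auto
    then show "y \<in> ?I" using je(3) by simp
  qed
  then have "cvec.span (vbasis m (Suc a + d)) \<subseteq> ?I" using subI by (rule cvec.span_minimal)
  then show ?thesis using vpoly_subset_span by (rule order_trans[rotated])
qed

lemma full_rank_at_zigzag:
  assumes "0 < m" "0 < d" "m < n"
  shows "full_rank_at d m n (m * d div (n - m)) (zigzag d m n)"
  unfolding full_rank_at_def
  using zigzag_POL zigzag_injective[OF assms] zigzag_surjective[OF assms] assms by blast

theorem theorem3p3:
  fixes m n d :: nat
  assumes "0 < m" and "0 < d" and "m < n"
  shows "(\<exists>K \<in> POL d m n. mat_degree K = d \<and> normal_rank K = m \<and>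
            complete_eigenstructure d K = K_rp d m n) \<and>
         (\<forall>K \<in> POL d m n. complete_eigenstructure d K = K_rp d m n \<longrightarrow>
            POL_topology d m n closure_of eig_orbit d K = POL d m n)"
proof (intro conjI ballI impI)
  let ?Z = "zigzag d m n" and ?a = "m * d div (n - m)"
  have full: "full_rank_at d m n ?a ?Z" by (rule full_rank_at_zigzag[OF assms])
  have eig: "complete_eigenstructure d Q = K_rp d m n" if "full_rank_at d m n ?a Q" for Q
    using that \<open>m < n\<close> by (rule complete_eigenstructure_full_rank(2))
  have "normal_rank ?Z = m" by (rule complete_eigenstructure_full_rank(1)[OF full \<open>m < n\<close>])
  then show "\<exists>K \<in> POL d m n. mat_degree K = d \<and> normal_rank K = m \<and>
      complete_eigenstructure d K = K_rp d m n"
    using zigzag_POL[OF \<open>0 < d\<close>] mat_degree_zigzag[OF assms] eig[OF full] by blast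
  \<comment> \<open>The orbit depends only on the eigenstructure, so it contains every full-rank
    matrix whichever \<open>K\<close> represents it.\<close>
  fix K assume K: "K \<in> POL d m n" "complete_eigenstructure d K = K_rp d m n"
  then have "eig_orbit d K = {Q \<in> POL d m n. complete_eigenstructure d Q = K_rp d m n}"
    by (simp add: eig_orbit_def dim_POL[OF K(1)])
  moreover have "{Q. full_rank_at d m n ?a Q} \<subseteq> {Q \<in> POL d m n. complete_eigenstructure d Q = K_rp d m n}"
    using eig by (auto simp: full_rank_at_def)
  ultimately show "POL_topology d m n closure_of eig_orbit d K = POL d m n"
    using closure_full_rank[OF full, of "eig_orbit d K"] by simp
qed

end
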